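(* Let $K$ be a finitely generated field with $\mathrm{char}(K)\neq2$ and $d:=\dim(K)>2$, let $k_0\subset K$ be a relatively algebraically closed global subfield, $e:=\mathrm{td}(K|k_0)-1>0$, and let $f,t_1,\dots,t_e\in K$ be algebraically independent over $k_0$ with each $t_i$ a square in $K$. Let $C$ be the projective normal curve over $k_0(t_1,\dots,t_e)$ with function field $K$, $D_f:=\{P\in C\text{ closed}\mid v_P(f)\notin 2\,v_P(K)\}$, $\Theta_{f,\mathbf t}:=\bigcup_{P\in D_f}U_P\cdot K^{\times2}$ and $\bar\Theta_{f,\mathbf t}:=\{\xi\in K^\times\mid \tfrac1\xi\notin\Theta_{f,\mathbf t}\text{ and }\tfrac1\xi-1\notin\Theta_{f,\mathbf t}\}$. Then $\mathfrak a_{f,\mathbf t}:=\bigcap_{P\in D_f}\mathfrak m_P=\bar\Theta_{f,\mathbf t}-\bar\Theta_{f,\mathbf t}$. Hence $\mathfrak a_{f,\mathbf t}\subset K$ is uniformly first-order definable, and thus so is the subring $R_{f,\mathbf t}=\bigcap_{P\in D_f}\mathcal O_P=\{r\in K\mid r\cdot\mathfrak a_{f,\mathbf t}\subset\mathfrak a_{f,\mathbf t}\}$ of $K$.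
   Context: Kronecker dimension $\dim$ = $\dim$ of prime field ($0$ for $\mathbb F_p$, $1$ for $\mathbb Q$) plus transcendence degree over it. For closed $P\in C$, $v_P$ is the discrete valuation with valuation ring $\mathcal O_P=\mathcal O_{C,P}$, maximal ideal $\mathfrak m_P$, and $U_P=\mathcal O_P^\times$. $A-B$ denotes $\{a-b\mid a\in A,b\in B\}$. Uniformly first-order definable means definable by a formula in the language of fields not depending on $K$, with $f,t_1,\dots,t_e$ (and the subfield $k_0$) as the given data. *)

theory Defs
  imports Main "HOL-Computational_Algebra.Polynomial"
begin

text \<open>Throughout, the ambient field K is the whole type 'a :: field.\<close>

definition subfield :: "'a::field set \<Rightarrow> bool" where
  "subfield S \<longleftrightarrow> 0 \<in> S \<and> 1 \<in> S \<and>
     (\<forall>x\<in>S. \<forall>y\<in>S. x + y \<in> S \<and> x * y \<in> S) \<and>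
     (\<forall>x\<in>S. - x \<in> S \<and> inverse x \<in> S)"

definition gen_subfield :: "'a::field set \<Rightarrow> 'a set" where
  "gen_subfield S = \<Inter>{F. subfield F \<and> S \<subseteq> F}"

definition prime_subfield :: "'a::field set" where
  "prime_subfield = gen_subfield {}"

definition fg_field :: "'a::field set \<Rightarrow> bool" where
  "fg_field L \<longleftrightarrow> subfield L \<and> (\<exists>S. finite S \<and> gen_subfield S = L)"

text \<open>Algebraic independence of a list over k: no nonzero polynomial with
  coefficients in k (coefficient function on exponent vectors, finite support,
  only variables 0..length xs - 1) vanishes at xs.\<close>
definition alg_indep :: "'a::field set \<Rightarrow> 'a list \<Rightarrow> bool" where
  "alg_indep k xs \<longleftrightarrow>
     (\<forall>c :: (nat \<Rightarrow> nat) \<Rightarrow> 'a.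
        finite {\<alpha>. c \<alpha> \<noteq> 0} \<and> (\<forall>\<alpha>. c \<alpha> \<in> k) \<and>
        (\<forall>\<alpha>. c \<alpha> \<noteq> 0 \<longrightarrow> (\<forall>i\<ge>length xs. \<alpha> i = 0)) \<and>
        (\<Sum>\<alpha>\<in>{\<alpha>. c \<alpha> \<noteq> 0}. c \<alpha> * (\<Prod>i<length xs. (xs ! i) ^ (\<alpha> i))) = 0
        \<longrightarrow> (\<forall>\<alpha>. c \<alpha> = 0))"

definition trdeg_in :: "'a::field set \<Rightarrow> 'a set \<Rightarrow> nat \<Rightarrow> bool" where
  "trdeg_in k L n \<longleftrightarrow>
     (\<exists>xs. set xs \<subseteq> L \<and> length xs = n \<and> alg_indep k xs) \<and>
     \<not> (\<exists>xs. set xs \<subseteq> L \<and> length xs = Suc n \<and> alg_indep k xs)"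

text \<open>Kronecker dimension: dim of prime field (1 for Q, 0 for F_p) plus
  transcendence degree over the prime field.\<close>
definition kdim :: "'a::field set \<Rightarrow> nat \<Rightarrow> bool" where
  "kdim L d \<longleftrightarrow> (\<exists>m. trdeg_in prime_subfield L m \<and>
       d = m + (if CHAR('a) = 0 then 1 else 0))"

definition global_subfield :: "'a::field set \<Rightarrow> bool" where
  "global_subfield k \<longleftrightarrow> fg_field k \<and> kdim k 1"

definition algebraic_over :: "'a::field set \<Rightarrow> 'a \<Rightarrow> bool" where
  "algebraic_over k x \<longleftrightarrow> (\<exists>p :: 'a poly. p \<noteq> 0 \<and> (\<forall>i. coeff p i \<in> k) \<and> poly p x = 0)"

definition rel_alg_closed :: "'a::field set \<Rightarrow> bool" where
  "rel_alg_closed k \<longleftrightarrow> (\<forall>x. algebraic_over k x \<longrightarrow> x \<in> k)"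

definition valuation_ring :: "'a::field set \<Rightarrow> bool" where
  "valuation_ring V \<longleftrightarrow> 0 \<in> V \<and> 1 \<in> V \<and>
     (\<forall>x\<in>V. \<forall>y\<in>V. x + y \<in> V \<and> x * y \<in> V \<and> - x \<in> V) \<and>
     (\<forall>x. x \<noteq> 0 \<longrightarrow> x \<in> V \<or> inverse x \<in> V)"

text \<open>Closed points of the projective normal curve over F with function field K
  correspond to the valuation rings O_P of K containing F and different from K.\<close>
definition curve_points :: "'a::field set \<Rightarrow> 'a set set" where
  "curve_points F = {V. valuation_ring V \<and> F \<subseteq> V \<and> V \<noteq> UNIV}"

definition vr_units :: "'a::field set \<Rightarrow> 'a set" where
  "vr_units V = {x \<in> V. x \<noteq> 0 \<and> inverse x \<in> V}"

definition max_ideal :: "'a::field set \<Rightarrow> 'a set" where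
  "max_ideal V = V - vr_units V"

definition unit_squares :: "'a::field set \<Rightarrow> 'a set" where
  "unit_squares V = {u * g ^ 2 | u g. u \<in> vr_units V \<and> g \<noteq> 0}"

text \<open>v_P(f) in 2 v_P(K^x) iff f = u g^2 with u a unit, g nonzero.\<close>
definition val_even :: "'a::field set \<Rightarrow> 'a \<Rightarrow> bool" where
  "val_even V f \<longleftrightarrow> (\<exists>g. g \<noteq> 0 \<and> f * inverse (g ^ 2) \<in> vr_units V)"

definition Dset :: "'a::field set \<Rightarrow> 'a \<Rightarrow> 'a set set" where
  "Dset F f = {V \<in> curve_points F. \<not> val_even V f}"

definition Theta :: "'a::field set \<Rightarrow> 'a \<Rightarrow> 'a set" where
  "Theta F f = (\<Union>V\<in>Dset F f. unit_squares V)"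

definition Theta_bar :: "'a::field set \<Rightarrow> 'a \<Rightarrow> 'a set" where
  "Theta_bar F f = {\<xi>. \<xi> \<noteq> 0 \<and> inverse \<xi> \<notin> Theta F f \<and> inverse \<xi> - 1 \<notin> Theta F f}"

definition ideal_a :: "'a::field set \<Rightarrow> 'a \<Rightarrow> 'a set" where
  "ideal_a F f = (\<Inter>V\<in>Dset F f. max_ideal V)"

definition ring_R :: "'a::field set \<Rightarrow> 'a \<Rightarrow> 'a set" where
  "ring_R F f = (\<Inter>V\<in>Dset F f. V)"

definition set_diff :: "'a::ab_group_add set \<Rightarrow> 'a set \<Rightarrow> 'a set" where
  "set_diff A B = {a - b | a b. a \<in> A \<and> b \<in> B}"

end

theory Submission
  imports Defs
begin

text \<open>Put \<open>h = f/(1 + f)\<^sup>2\<close>. The places of \<open>K\<close> over \<open>F = k\<^sub>0(t)\<close> at which \<open>h\<close> is positive are the zeros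
  and poles of \<open>f\<close>; they include \<open>D\<^sub>f\<close>. As \<open>K\<close> is finitely generated and algebraic over \<open>F(f)\<close>,
  each of them carries a rational valuation normalised by \<open>v(h) = 1\<close>, elements of \<open>F(f)\<close> take the
  same value at all zeros (all poles) of \<open>f\<close>, and \<open>K\<close> is finite-dimensional over \<open>F(f)\<close>; linear
  independence of approximate idempotents then shows that there are finitely many such places, and
  they satisfy weak approximation.

  An element \<open>\<xi>\<close> of \<open>\<Theta>\<close>-bar lies in every \<open>m\<^sub>P\<close> with \<open>P \<in> D\<^sub>f\<close>, since otherwise \<open>1/\<xi>\<close> or \<open>1/\<xi> - 1\<close> would be
  a unit at \<open>P\<close>. Conversely, at \<open>P \<in> D\<^sub>f\<close> the value \<open>1 = v(h)\<close> is odd, because \<open>v(f) = \<plusminus>1\<close> is; so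
  for \<open>x\<close> in the ideal \<open>a\<close> there is locally an element \<open>z\<close> such that \<open>z\<close> and \<open>z - x\<close> have positive odd value.
  Approximation glues these into one \<open>\<xi>\<close>, and \<open>x = \<xi> - (\<xi> - x)\<close> where elements of positive odd value at
  all \<open>P \<in> D\<^sub>f\<close> lie in \<open>\<Theta>\<close>-bar. Approximation also shows that \<open>R\<close> is the multiplier ring of \<open>a\<close>.\<close>

section \<open>Subfields\<close>

lemma subfield_0: "subfield S \<Longrightarrow> 0 \<in> S" by (simp add: subfield_def)
lemma subfield_1: "subfield S \<Longrightarrow> 1 \<in> S" by (simp add: subfield_def)
lemma subfield_add: "subfield S \<Longrightarrow> x \<in> S \<Longrightarrow> y \<in> S \<Longrightarrow> x + y \<in> S" by (simp add: subfield_def)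
lemma subfield_mult: "subfield S \<Longrightarrow> x \<in> S \<Longrightarrow> y \<in> S \<Longrightarrow> x * y \<in> S" by (simp add: subfield_def)
lemma subfield_uminus: "subfield S \<Longrightarrow> x \<in> S \<Longrightarrow> - x \<in> S" by (simp add: subfield_def)
lemma subfield_inverse: "subfield S \<Longrightarrow> x \<in> S \<Longrightarrow> inverse x \<in> S" by (simp add: subfield_def)

lemma subfield_diff: "subfield S \<Longrightarrow> x \<in> S \<Longrightarrow> y \<in> S \<Longrightarrow> x - y \<in> S"
  using subfield_add[of S x "- y"] subfield_uminus[of S y] by simp

lemma subfield_divide: "subfield S \<Longrightarrow> x \<in> S \<Longrightarrow> y \<in> S \<Longrightarrow> x / y \<in> S"
  by (simp add: divide_inverse subfield_mult subfield_inverse)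

lemma subfield_sum: "subfield S \<Longrightarrow> (\<And>i. i \<in> A \<Longrightarrow> g i \<in> S) \<Longrightarrow> sum g A \<in> S"
  by (induction A rule: infinite_finite_induct) (auto simp: subfield_0 subfield_add)

lemma subfield_gen_subfield: "subfield (gen_subfield S)"
  unfolding gen_subfield_def subfield_def by auto

lemma gen_subfield_superset: "S \<subseteq> gen_subfield S"
  unfolding gen_subfield_def by auto

lemma gen_subfield_minimal: "subfield T \<Longrightarrow> S \<subseteq> T \<Longrightarrow> gen_subfield S \<subseteq> T"
  unfolding gen_subfield_def by auto

section \<open>Valuation rings\<close>

context
  fixes V :: "'a::field set"
  assumes vr: "valuation_ring V"
begin

lemma vr_0: "0 \<in> V" using vr by (simp add: valuation_ring_def)
lemma vr_1: "1 \<in> V" using vr by (simp add: valuation_ring_def)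
lemma vr_add: "x \<in> V \<Longrightarrow> y \<in> V \<Longrightarrow> x + y \<in> V" using vr by (simp add: valuation_ring_def)
lemma vr_mult: "x \<in> V \<Longrightarrow> y \<in> V \<Longrightarrow> x * y \<in> V" using vr by (simp add: valuation_ring_def)
lemma vr_uminus: "x \<in> V \<Longrightarrow> - x \<in> V" using vr by (simp add: valuation_ring_def)
lemma vr_total: "x \<noteq> 0 \<Longrightarrow> x \<in> V \<or> inverse x \<in> V" using vr by (simp add: valuation_ring_def)

lemma vr_power: "x \<in> V \<Longrightarrow> x ^ n \<in> V"
  by (induction n) (auto simp: vr_1 vr_mult)

lemma vr_mem_if_power_mem:
  assumes "x ^ N \<in> V" "N > 0"
  shows "x \<in> V"
proof (rule ccontr)
  assume x: "x \<notin> V"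
  then have "x \<noteq> 0" using vr_0 by auto
  then have "inverse x \<in> V" using vr_total x by blast
  moreover have "x = x ^ N * inverse x ^ (N - 1)"
    using \<open>x \<noteq> 0\<close> \<open>N > 0\<close> by (cases N) (simp_all add: power_inverse)
  ultimately show False using assms x vr_mult vr_power by metis
qed

lemma vr_units_iff: "u \<in> vr_units V \<longleftrightarrow> u \<in> V \<and> u \<noteq> 0 \<and> inverse u \<in> V"
  by (simp add: vr_units_def)

lemma max_ideal_iff: "y \<in> max_ideal V \<longleftrightarrow> y \<in> V \<and> (y = 0 \<or> inverse y \<notin> V)"
  by (auto simp: max_ideal_def vr_units_def)

lemma vr_units_1: "1 \<in> vr_units V" by (simp add: vr_units_iff vr_1)
lemma vr_units_nonzero: "u \<in> vr_units V \<Longrightarrow> u \<noteq> 0" by (simp add: vr_units_iff)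
lemma vr_units_mem: "u \<in> vr_units V \<Longrightarrow> u \<in> V" by (simp add: vr_units_iff)

lemma vr_units_mult: "u \<in> vr_units V \<Longrightarrow> w \<in> vr_units V \<Longrightarrow> u * w \<in> vr_units V"
  by (auto simp: vr_units_iff vr_mult)

lemma vr_units_inverse: "u \<in> vr_units V \<Longrightarrow> inverse u \<in> vr_units V"
  by (auto simp: vr_units_iff)

lemma vr_units_divide: "u \<in> vr_units V \<Longrightarrow> w \<in> vr_units V \<Longrightarrow> u / w \<in> vr_units V"
  by (simp add: divide_inverse vr_units_mult vr_units_inverse)

lemma vr_units_power: "u \<in> vr_units V \<Longrightarrow> u ^ n \<in> vr_units V"
  by (induction n) (auto simp: vr_units_1 vr_units_mult)

lemma vr_units_uminus: "u \<in> vr_units V \<Longrightarrow> - u \<in> vr_units V"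
  by (auto simp: vr_units_iff vr_uminus)

lemma vr_units_subfield: "subfield F \<Longrightarrow> F \<subseteq> V \<Longrightarrow> c \<in> F \<Longrightarrow> c \<noteq> 0 \<Longrightarrow> c \<in> vr_units V"
  by (auto simp: vr_units_iff subfield_inverse)

lemma max_ideal_0: "0 \<in> max_ideal V" by (simp add: max_ideal_iff vr_0)

lemma max_ideal_not_unit: "y \<in> max_ideal V \<Longrightarrow> y \<notin> vr_units V"
  by (auto simp: max_ideal_iff vr_units_iff)

lemma vr_mem_cases: "y \<in> V \<Longrightarrow> y \<in> vr_units V \<or> y \<in> max_ideal V"
  by (auto simp: max_ideal_iff vr_units_iff)

lemma max_ideal_mult:
  assumes r: "r \<in> V" and y: "y \<in> max_ideal V"
  shows "r * y \<in> max_ideal V"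
proof -
  have "inverse y \<in> V" if "r * y \<noteq> 0" "inverse (r * y) \<in> V"
  proof -
    have "inverse y = r * inverse (r * y)" using that(1) by (simp add: field_simps)
    then show ?thesis using r that(2) vr_mult by metis
  qed
  then show ?thesis using assms vr_mult by (auto simp: max_ideal_iff)
qed

lemma max_ideal_add:
  assumes y: "y \<in> max_ideal V" and z: "z \<in> max_ideal V"
  shows "y + z \<in> max_ideal V"
proof -
  have dominant: "a + b \<in> max_ideal V" if "a \<in> max_ideal V" "a \<noteq> 0" "b / a \<in> V" for a b
  proof -
    have "a + b = (1 + b / a) * a" using \<open>a \<noteq> 0\<close> by (simp add: field_simps)
    then show ?thesis using that vr_1 vr_add max_ideal_mult by metis
  qed
  consider "y = 0" | "z = 0" | "y \<noteq> 0" "z \<noteq> 0" by blast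
  then show ?thesis
  proof cases
    case 3
    then have "z / y \<in> V \<or> y / z \<in> V" using vr_total[of "z / y"] by auto
    then show ?thesis using dominant[OF y \<open>y \<noteq> 0\<close>] dominant[OF z \<open>z \<noteq> 0\<close>]
      by (metis add.commute)
  qed (use y z in auto)
qed

lemma max_ideal_uminus: "y \<in> max_ideal V \<Longrightarrow> - y \<in> max_ideal V"
  using max_ideal_mult[of "- 1" y] vr_1 vr_uminus by auto

lemma max_ideal_diff: "y \<in> max_ideal V \<Longrightarrow> z \<in> max_ideal V \<Longrightarrow> y - z \<in> max_ideal V"
  using max_ideal_add[of y "- z"] max_ideal_uminus by auto

lemma max_ideal_sum: "(\<And>i. i \<in> A \<Longrightarrow> g i \<in> max_ideal V) \<Longrightarrow> sum g A \<in> max_ideal V"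
  by (induction A rule: infinite_finite_induct) (auto simp: max_ideal_0 max_ideal_add)

lemma vr_units_add_max_ideal:
  assumes u: "u \<in> vr_units V" and y: "y \<in> max_ideal V"
  shows "u + y \<in> vr_units V"
proof (rule ccontr)
  assume "u + y \<notin> vr_units V"
  moreover have "u + y \<in> V" using assms vr_units_mem vr_add by (auto simp: max_ideal_iff)
  ultimately have "(u + y) - y \<in> max_ideal V" using vr_mem_cases max_ideal_diff y by blast
  then show False using u max_ideal_not_unit by simp
qed

lemma vr_exists_min:
  assumes "finite J" "J \<noteq> {}" "\<forall>j\<in>J. T j \<noteq> 0"
  shows "\<exists>i\<in>J. \<forall>j\<in>J. T j / T i \<in> V"
  using assms
proof (induction J rule: finite_ne_induct)
  case (singleton x)
  then show ?case using vr_1 by simp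
next
  case (insert x J)
  then obtain i where i: "i \<in> J" "\<forall>j\<in>J. T j / T i \<in> V" by auto
  have nz: "T x \<noteq> 0" "T i \<noteq> 0" using insert i by auto
  show ?case
  proof (cases "T i / T x \<in> V")
    case True
    have "T j / T x = (T j / T i) * (T i / T x)" for j using nz by simp
    then have "\<forall>j\<in>J. T j / T x \<in> V" using i True vr_mult by metis
    then show ?thesis using nz vr_1 by auto
  next
    case False
    then have "T x / T i \<in> V" using vr_total[of "T i / T x"] nz by auto
    then show ?thesis using i by auto
  qed
qed

lemma vr_vanishing_sum:
  assumes J: "finite J" "J \<noteq> {}" and T: "\<forall>j\<in>J. T j \<noteq> 0" and sum0: "sum T J = 0"
  shows "\<exists>i\<in>J. \<exists>j\<in>J. i \<noteq> j \<and> T j / T i \<in> vr_units V"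
proof (rule ccontr)
  assume none: "\<not> ?thesis"
  obtain i where i: "i \<in> J" "\<forall>j\<in>J. T j / T i \<in> V" using vr_exists_min[OF J T] by blast
  have "T j / T i \<in> max_ideal V" if "j \<in> J - {i}" for j
  proof -
    have "T j / T i \<notin> vr_units V" using none i(1) that by auto
    then show ?thesis using vr_mem_cases i(2) that by blast
  qed
  then have "(\<Sum>j\<in>J - {i}. T j / T i) \<in> max_ideal V" by (rule max_ideal_sum)
  then have u: "1 + (\<Sum>j\<in>J - {i}. T j / T i) \<in> vr_units V"
    by (rule vr_units_add_max_ideal[OF vr_units_1])
  have "T i * (\<Sum>j\<in>J - {i}. T j / T i) = (\<Sum>j\<in>J - {i}. T j)"
    using T i(1) by (simp add: sum_distrib_left)
  then have "T i * (1 + (\<Sum>j\<in>J - {i}. T j / T i)) = sum T J"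
    using sum.remove[OF J(1) i(1), of T] by (simp add: distrib_left)
  then have "T i * (1 + (\<Sum>j\<in>J - {i}. T j / T i)) = 0" using sum0 by simp
  then show False using u T i(1) vr_units_nonzero by auto
qed

end

section \<open>Polynomials with coefficients in a subset\<close>

definition poly_over :: "'a::comm_ring_1 set \<Rightarrow> 'a poly \<Rightarrow> bool" where
  "poly_over F p \<longleftrightarrow> (\<forall>i. coeff p i \<in> F)"

lemma algebraic_over_iff: "algebraic_over k x \<longleftrightarrow> (\<exists>p. p \<noteq> 0 \<and> poly_over k p \<and> poly p x = 0)"
  by (simp add: algebraic_over_def poly_over_def)

lemma poly_over_pCons: "poly_over F (pCons a p) \<longleftrightarrow> a \<in> F \<and> poly_over F p"
  unfolding poly_over_def by (metis coeff_pCons_0 coeff_pCons_Suc not0_implies_Suc)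

lemma poly_over_mono: "F \<subseteq> G \<Longrightarrow> poly_over F p \<Longrightarrow> poly_over G p"
  unfolding poly_over_def by blast

lemma algebraic_over_mono: "F \<subseteq> G \<Longrightarrow> algebraic_over F x \<Longrightarrow> algebraic_over G x"
  using poly_over_mono by (metis algebraic_over_iff)

lemma poly_over_add: "subfield F \<Longrightarrow> poly_over F p \<Longrightarrow> poly_over F q \<Longrightarrow> poly_over F (p + q)"
  unfolding poly_over_def by (auto simp: subfield_add)

lemma poly_over_uminus: "subfield F \<Longrightarrow> poly_over F p \<Longrightarrow> poly_over F (- p)"
  unfolding poly_over_def by (auto simp: subfield_uminus)

lemma poly_over_mult: "subfield F \<Longrightarrow> poly_over F p \<Longrightarrow> poly_over F q \<Longrightarrow> poly_over F (p * q)"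
  unfolding poly_over_def by (auto simp: coeff_mult intro!: subfield_sum subfield_mult)

lemma poly_over_const: "subfield F \<Longrightarrow> c \<in> F \<Longrightarrow> poly_over F [:c:]"
  unfolding poly_over_def by (auto simp: coeff_pCons subfield_0 split: nat.splits)

lemma poly_over_X: "subfield F \<Longrightarrow> poly_over F [:0, 1:]"
  unfolding poly_over_def by (auto simp: coeff_pCons subfield_0 subfield_1 split: nat.splits)

lemma poly_over_reflect: "subfield F \<Longrightarrow> poly_over F p \<Longrightarrow> poly_over F (reflect_poly p)"
  unfolding poly_over_def by (auto simp: coeff_reflect_poly subfield_0)

lemma poly_mem_if_closed:
  assumes "0 \<in> S" "\<And>a b. a \<in> S \<Longrightarrow> b \<in> S \<Longrightarrow> a + b \<in> S" "\<And>a b. a \<in> S \<Longrightarrow> b \<in> S \<Longrightarrow> a * b \<in> S"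
    and "F \<subseteq> S" "poly_over F p" "x \<in> S"
  shows "poly p x \<in> S"
  using assms(5) by (induction p) (use assms in \<open>auto simp: poly_over_pCons\<close>)

lemma poly_over_factor_power:
  assumes "poly_over F p" "p \<noteq> 0"
  shows "\<exists>m q. poly_over F q \<and> coeff q 0 \<noteq> 0 \<and> (\<forall>x. poly p x = x ^ m * poly q x)"
  using assms
proof (induction p)
  case (pCons a p)
  show ?case
  proof (cases "a = 0")
    case False
    then show ?thesis using pCons.prems by (intro exI[of _ 0] exI[of _ "pCons a p"]) auto
  next
    case True
    then obtain m q where "poly_over F q" "coeff q 0 \<noteq> 0" "\<forall>x. poly p x = x ^ m * poly q x"
      using pCons by (auto simp: poly_over_pCons)
    then show ?thesis using True by (intro exI[of _ "Suc m"] exI[of _ q]) auto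
  qed
qed simp

lemma poly_over_unit:
  assumes vr: "valuation_ring V" and F: "subfield F" "F \<subseteq> V"
    and q: "poly_over F q" "coeff q 0 \<noteq> 0" and x: "x \<in> max_ideal V"
  shows "poly q x \<in> vr_units V"
proof -
  obtain c q' where q': "q = pCons c q'" by (cases q)
  have "c \<in> vr_units V" using q q' vr_units_subfield[OF vr F] by (simp add: poly_over_pCons)
  moreover have "poly q' x \<in> V"
    using q q' x vr F(2) by (intro poly_mem_if_closed[of V F]) (auto simp: poly_over_pCons vr_0 vr_add vr_mult max_ideal_iff)
  then have "x * poly q' x \<in> max_ideal V" using max_ideal_mult[OF vr _ x] by (metis mult.commute)
  ultimately show ?thesis using q' vr_units_add_max_ideal[OF vr] by simp
qed

lemma algebraic_over_monic_relation:
  assumes E: "subfield E" and s: "algebraic_over E s"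
  shows "\<exists>d b. d \<ge> 1 \<and> (\<forall>j<d. b j \<in> E) \<and> s ^ d = (\<Sum>j<d. b j * s ^ j)"
proof -
  obtain p where p: "p \<noteq> 0" "poly_over E p" "poly p s = 0" using s by (auto simp: algebraic_over_iff)
  define d where "d = degree p"
  have "d \<noteq> 0"
  proof
    assume "d = 0"
    then obtain a where "p = [:a:]" unfolding d_def by (elim degree_eq_zeroE)
    then show False using p(1,3) by simp
  qed
  have "lead_coeff p * s ^ d + (\<Sum>j<d. coeff p j * s ^ j) = 0"
    using p(3) by (simp add: poly_altdef d_def lessThan_Suc_atMost[symmetric] add.commute)
  then have "s ^ d = (\<Sum>j<d. (- coeff p j / lead_coeff p) * s ^ j)"
    using p(1) by (simp add: field_simps sum_divide_distrib[symmetric] sum_negf eq_neg_iff_add_eq_0)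
  moreover have "- coeff p j / lead_coeff p \<in> E" for j
    using p(2) E by (simp add: poly_over_def subfield_divide subfield_uminus)
  ultimately show ?thesis using \<open>d \<noteq> 0\<close> by (intro exI[of _ d] exI[of _ "\<lambda>j. - coeff p j / lead_coeff p"]) auto
qed

section \<open>The ring \<open>F[f]\<close>\<close>

definition adjoin_ring :: "'a::comm_ring_1 set \<Rightarrow> 'a \<Rightarrow> 'a set" where
  "adjoin_ring F f = {poly p f | p. poly_over F p}"

lemma adjoin_ringI: "poly_over F p \<Longrightarrow> a = poly p f \<Longrightarrow> a \<in> adjoin_ring F f"
  unfolding adjoin_ring_def by auto

lemma adjoin_ringE: "a \<in> adjoin_ring F f \<Longrightarrow> (\<And>p. poly_over F p \<Longrightarrow> a = poly p f \<Longrightarrow> thesis) \<Longrightarrow> thesis"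
  unfolding adjoin_ring_def by auto

context
  fixes F :: "'a::field set"
  assumes F: "subfield F"
begin

lemma adjoin_ring_add: "a \<in> adjoin_ring F f \<Longrightarrow> b \<in> adjoin_ring F f \<Longrightarrow> a + b \<in> adjoin_ring F f"
  by (elim adjoin_ringE, rule adjoin_ringI[OF poly_over_add[OF F]]) auto

lemma adjoin_ring_mult: "a \<in> adjoin_ring F f \<Longrightarrow> b \<in> adjoin_ring F f \<Longrightarrow> a * b \<in> adjoin_ring F f"
  by (elim adjoin_ringE, rule adjoin_ringI[OF poly_over_mult[OF F]]) auto

lemma adjoin_ring_uminus: "a \<in> adjoin_ring F f \<Longrightarrow> - a \<in> adjoin_ring F f"
  by (elim adjoin_ringE, rule adjoin_ringI[OF poly_over_uminus[OF F]]) auto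

lemma adjoin_ring_const: "c \<in> F \<Longrightarrow> c \<in> adjoin_ring F f"
  by (rule adjoin_ringI[OF poly_over_const[OF F]]) auto

lemma adjoin_ring_generator: "f \<in> adjoin_ring F f"
  by (rule adjoin_ringI[OF poly_over_X[OF F]]) auto

lemma adjoin_ring_sum: "(\<And>i. i \<in> I \<Longrightarrow> g i \<in> adjoin_ring F f) \<Longrightarrow> sum g I \<in> adjoin_ring F f"
  by (induction I rule: infinite_finite_induct) (auto simp: adjoin_ring_add adjoin_ring_const subfield_0[OF F])

lemma adjoin_ring_prod: "(\<And>i. i \<in> I \<Longrightarrow> g i \<in> adjoin_ring F f) \<Longrightarrow> prod g I \<in> adjoin_ring F f"
  by (induction I rule: infinite_finite_induct) (auto simp: adjoin_ring_mult adjoin_ring_const subfield_1[OF F])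

lemma adjoin_ring_power: "a \<in> adjoin_ring F f \<Longrightarrow> a ^ n \<in> adjoin_ring F f"
  by (induction n) (auto simp: adjoin_ring_mult adjoin_ring_const subfield_1[OF F])

end

section \<open>Linear algebra over a subfield\<close>

text \<open>One step of Gaussian elimination: clearing the column \<open>j0\<close> with the pivot row \<open>i0\<close> turns a
  relation \<open>c'\<close> among the remaining rows of the reduced matrix into a relation among all rows.\<close>

lemma sum_eliminate_pivot:
  fixes u :: "'i \<Rightarrow> 'j \<Rightarrow> 'a::field"
  assumes "finite I" "i0 \<in> I"
  shows "(\<Sum>i\<in>I. (c'(i0 := - (\<Sum>i\<in>I - {i0}. c' i * u i j0) / u i0 j0)) i * u i j)
    = (\<Sum>i\<in>I - {i0}. c' i * (u i j - u i j0 / u i0 j0 * u i0 j))"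
proof -
  let ?c = "c'(i0 := - (\<Sum>i\<in>I - {i0}. c' i * u i j0) / u i0 j0)"
  have "(\<Sum>i\<in>I. ?c i * u i j) = ?c i0 * u i0 j + (\<Sum>i\<in>I - {i0}. ?c i * u i j)"
    using sum.remove[OF assms] .
  also have "(\<Sum>i\<in>I - {i0}. ?c i * u i j) = (\<Sum>i\<in>I - {i0}. c' i * u i j)"
    by (rule sum.cong) auto
  finally show ?thesis
    by (simp add: algebra_simps sum_subtractf sum_distrib_left sum_distrib_right sum_divide_distrib)
qed

lemma homogeneous_system_nontrivial_solution:
  fixes u :: "'i \<Rightarrow> 'j \<Rightarrow> 'a::field"
  assumes E: "subfield E" and J: "finite J"
  shows "finite I \<Longrightarrow> card J < card I \<Longrightarrow> \<forall>i\<in>I. \<forall>j\<in>J. u i j \<in> E \<Longrightarrow>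
    \<exists>c. (\<forall>i\<in>I. c i \<in> E) \<and> (\<exists>i\<in>I. c i \<noteq> 0) \<and> (\<forall>j\<in>J. (\<Sum>i\<in>I. c i * u i j) = 0)"
  using J
proof (induction J arbitrary: I u rule: finite_induct)
  case empty
  then obtain i0 where "i0 \<in> I" by fastforce
  then show ?case using E by (intro exI[of _ "\<lambda>i. if i = i0 then 1 else 0"]) (auto simp: subfield_0 subfield_1)
next
  case (insert j0 J)
  show ?case
  proof (cases "\<forall>i\<in>I. u i j0 = 0")
    case True
    then show ?thesis using insert.IH[of I u] insert.prems insert.hyps by auto
  next
    case False
    then obtain i0 where i0: "i0 \<in> I" "u i0 j0 \<noteq> 0" by blast
    define u' where "u' i j = u i j - u i j0 / u i0 j0 * u i0 j" for i j
    have "\<forall>i\<in>I - {i0}. \<forall>j\<in>J. u' i j \<in> E" using insert.prems i0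
      by (auto simp: u'_def intro!: subfield_diff[OF E] subfield_mult[OF E] subfield_divide[OF E])
    moreover have "finite (I - {i0})" "card J < card (I - {i0})"
      using insert.prems insert.hyps i0 by (auto simp: card_Diff_singleton)
    ultimately obtain c' where c': "\<forall>i\<in>I - {i0}. c' i \<in> E" "\<exists>i\<in>I - {i0}. c' i \<noteq> 0"
      "\<forall>j\<in>J. (\<Sum>i\<in>I - {i0}. c' i * u' i j) = 0"
      using insert.IH by blast
    define c where "c = c'(i0 := - (\<Sum>i\<in>I - {i0}. c' i * u i j0) / u i0 j0)"
    have "(\<Sum>i\<in>I. c i * u i j) = (\<Sum>i\<in>I - {i0}. c' i * u' i j)" for j
      unfolding c_def u'_def using sum_eliminate_pivot[OF insert.prems(1) i0(1)] .
    moreover have "(\<Sum>i\<in>I - {i0}. c' i * u' i j0) = 0" using i0(2) by (simp add: u'_def)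
    ultimately have "\<forall>j\<in>insert j0 J. (\<Sum>i\<in>I. c i * u i j) = 0" using c'(3) by simp
    moreover have "\<forall>i\<in>I. c i \<in> E"
      using c'(1) i0 insert.prems(3) E
      by (auto simp: c_def intro!: subfield_uminus subfield_divide subfield_sum subfield_mult)
    moreover have "\<exists>i\<in>I. c i \<noteq> 0" using c'(2) by (auto simp: c_def)
    ultimately show ?thesis by blast
  qed
qed

definition span_over :: "'a::field set \<Rightarrow> 'a set \<Rightarrow> 'a set" where
  "span_over E W = {\<Sum>w\<in>W. a w * w | a. \<forall>w\<in>W. a w \<in> E}"

definition spans_subring :: "'a::field set \<Rightarrow> 'a set \<Rightarrow> bool" where
  "spans_subring E W \<longleftrightarrow> 1 \<in> span_over E W \<and> (\<forall>a\<in>W. \<forall>b\<in>W. a * b \<in> span_over E W)"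

context
  fixes E :: "'a::field set"
  assumes E: "subfield E"
begin

lemma span_overI: "(\<forall>w\<in>W. a w \<in> E) \<Longrightarrow> x = (\<Sum>w\<in>W. a w * w) \<Longrightarrow> x \<in> span_over E W"
  unfolding span_over_def by blast

lemma span_overE:
  "x \<in> span_over E W \<Longrightarrow> (\<And>a. \<forall>w\<in>W. a w \<in> E \<Longrightarrow> x = (\<Sum>w\<in>W. a w * w) \<Longrightarrow> thesis) \<Longrightarrow> thesis"
  unfolding span_over_def by blast

lemma span_over_0: "0 \<in> span_over E W"
  by (rule span_overI[where a = "\<lambda>_. 0"]) (auto simp: subfield_0[OF E])

lemma span_over_add:
  assumes "x \<in> span_over E W" "y \<in> span_over E W"
  shows "x + y \<in> span_over E W"
proof -
  obtain a where "\<forall>w\<in>W. a w \<in> E" "x = (\<Sum>w\<in>W. a w * w)" using assms(1) by (rule span_overE)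
  moreover obtain b where "\<forall>w\<in>W. b w \<in> E" "y = (\<Sum>w\<in>W. b w * w)" using assms(2) by (rule span_overE)
  ultimately show ?thesis
    by (intro span_overI[where a = "\<lambda>w. a w + b w"]) (auto simp: subfield_add[OF E] sum.distrib algebra_simps)
qed

lemma span_over_smult:
  assumes "c \<in> E" "x \<in> span_over E W"
  shows "c * x \<in> span_over E W"
proof -
  obtain a where "\<forall>w\<in>W. a w \<in> E" "x = (\<Sum>w\<in>W. a w * w)" using assms(2) by (rule span_overE)
  then show ?thesis using assms(1)
    by (intro span_overI[where a = "\<lambda>w. c * a w"]) (auto simp: subfield_mult[OF E] sum_distrib_left algebra_simps)
qed

lemma span_over_uminus: "x \<in> span_over E W \<Longrightarrow> - x \<in> span_over E W"
  using span_over_smult[of "- 1" x] subfield_uminus[OF E subfield_1[OF E]] by simp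

lemma span_over_sum: "(\<And>i. i \<in> I \<Longrightarrow> g i \<in> span_over E W) \<Longrightarrow> sum g I \<in> span_over E W"
  by (induction I rule: infinite_finite_induct) (auto simp: span_over_0 span_over_add)

lemma span_over_generator:
  assumes "finite W" "w \<in> W"
  shows "w \<in> span_over E W"
proof (rule span_overI[where a = "\<lambda>v. if v = w then 1 else 0"])
  have "(\<Sum>v\<in>W. (if v = w then 1 else 0) * v) = (\<Sum>v\<in>W. if v = w then v else 0)"
    by (rule sum.cong) auto
  then show "w = (\<Sum>v\<in>W. (if v = w then 1 else 0) * v)" using assms by simp
qed (auto simp: subfield_0[OF E] subfield_1[OF E])

lemma span_over_subset: "W \<subseteq> span_over E W' \<Longrightarrow> span_over E W \<subseteq> span_over E W'"
  by (auto elim!: span_overE intro!: span_over_sum span_over_smult)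

lemma span_over_mult_image:
  assumes "finite A" "finite B" "x \<in> span_over E A" "y \<in> span_over E B"
  shows "x * y \<in> span_over E ((\<lambda>(a, b). a * b) ` (A \<times> B))"
proof -
  obtain a where a: "\<forall>v\<in>A. a v \<in> E" "x = (\<Sum>v\<in>A. a v * v)" using assms(3) by (rule span_overE)
  obtain b where b: "\<forall>w\<in>B. b w \<in> E" "y = (\<Sum>w\<in>B. b w * w)" using assms(4) by (rule span_overE)
  have "x * y = (\<Sum>v\<in>A. \<Sum>w\<in>B. (a v * b w) * (v * w))"
    unfolding a(2) b(2) sum_product by (simp add: algebra_simps)
  also have "\<dots> \<in> span_over E ((\<lambda>(a, b). a * b) ` (A \<times> B))"
    using assms(1,2) a(1) b(1)
    by (intro span_over_sum span_over_smult subfield_mult[OF E] span_over_generator) auto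
  finally show ?thesis .
qed

lemma span_over_mult:
  assumes W: "finite W" "spans_subring E W" and xy: "x \<in> span_over E W" "y \<in> span_over E W"
  shows "x * y \<in> span_over E W"
proof -
  have "(\<lambda>(a, b). a * b) ` (W \<times> W) \<subseteq> span_over E W" using W(2) by (auto simp: spans_subring_def)
  then show ?thesis using span_over_mult_image[OF W(1) W(1) xy] span_over_subset by blast
qed

lemma power_mem_span_over_lower_powers:
  assumes b: "\<forall>j<d. b j \<in> E" and s: "s ^ d = (\<Sum>j<d. b j * s ^ j)"
  shows "s ^ k \<in> span_over E (power s ` {..<d})"
proof (induction k rule: less_induct)
  case (less k)
  show ?case
  proof (cases "k < d")
    case True
    then show ?thesis by (intro span_over_generator) auto
  next
    case False
    then have "s ^ k = s ^ (k - d) * s ^ d" by (simp flip: power_add)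
    also have "\<dots> = (\<Sum>j<d. b j * s ^ (k - d + j))"
      by (simp add: s sum_distrib_left power_add algebra_simps)
    also have "\<dots> \<in> span_over E (power s ` {..<d})"
      using False b less.IH by (intro span_over_sum span_over_smult) auto
    finally show ?thesis .
  qed
qed

lemma spans_subring_extend:
  assumes W: "finite W" "spans_subring E W" and s: "algebraic_over E s"
  shows "\<exists>W'. finite W' \<and> spans_subring E W' \<and> span_over E W \<subseteq> span_over E W' \<and> s \<in> span_over E W'"
proof -
  obtain d b where db: "\<forall>j<d. b j \<in> E" "s ^ d = (\<Sum>j<d. b j * s ^ j)"
    using algebraic_over_monic_relation[OF E s] by blast
  define W' where "W' = (\<lambda>(a, b). a * b) ` (W \<times> power s ` {..<d})"
  have W': "finite W'" using W(1) by (simp add: W'_def)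
  have times_power: "x * s ^ k \<in> span_over E W'" if "x \<in> span_over E W" for x k
    unfolding W'_def using W(1) that power_mem_span_over_lower_powers[OF db]
    by (intro span_over_mult_image) auto
  have one: "1 \<in> span_over E W" using W(2) by (simp add: spans_subring_def)
  have "span_over E W \<subseteq> span_over E W'" using times_power[of _ 0] by auto
  moreover have "s \<in> span_over E W'" using times_power[OF one, of 1] by simp
  moreover have "spans_subring E W'"
    unfolding spans_subring_def
  proof (intro conjI ballI)
    show "1 \<in> span_over E W'" using times_power[OF one, of 0] by simp
    fix x y assume "x \<in> W'" "y \<in> W'"
    then obtain v w i j where "v \<in> W" "w \<in> W" "x = v * s ^ i" "y = w * s ^ j"
      unfolding W'_def by auto
    moreover have "v * w \<in> span_over E W" using W(2) \<open>v \<in> W\<close> \<open>w \<in> W\<close> by (simp add: spans_subring_def)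
    ultimately show "x * y \<in> span_over E W'"
      using times_power[of "v * w" "i + j"] by (simp add: power_add algebra_simps)
  qed
  ultimately show ?thesis using W' by blast
qed

lemma span_over_inverse:
  assumes W: "finite W" "spans_subring E W" and z: "z \<in> span_over E W" "algebraic_over E z"
  shows "inverse z \<in> span_over E W"
proof (cases "z = 0")
  case True
  then show ?thesis using span_over_0 by simp
next
  case False
  obtain p where p: "p \<noteq> 0" "poly_over E p" "poly p z = 0" using z(2) by (auto simp: algebraic_over_iff)
  then obtain m q where q: "poly_over E q" "coeff q 0 \<noteq> 0" "poly p z = z ^ m * poly q z"
    using poly_over_factor_power by blast
  obtain c q' where q': "q = pCons c q'" by (cases q)
  have c: "c \<in> E" "c \<noteq> 0" and "poly_over E q'" using q q' by (auto simp: poly_over_pCons)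
  have "E \<subseteq> span_over E W"
    using W(2) span_over_smult[of _ 1] by (auto simp: spans_subring_def)
  then have "poly q' z \<in> span_over E W"
    using \<open>poly_over E q'\<close> z(1) span_over_0 span_over_add span_over_mult[OF W]
    by (intro poly_mem_if_closed) auto
  moreover have "c + z * poly q' z = 0" using p(3) q(3) q' False by simp
  then have "c = - (z * poly q' z)" by (simp add: eq_neg_iff_add_eq_0)
  then have "inverse z = - inverse c * poly q' z" using c(2) by (simp add: field_simps)
  ultimately show ?thesis using c span_over_smult subfield_uminus[OF E] subfield_inverse[OF E] by metis
qed

lemma finite_span_if_algebraic:
  assumes fg: "fg_field (UNIV :: 'a set)" and alg: "\<And>y. algebraic_over E y"
  shows "\<exists>W. finite W \<and> span_over E W = UNIV"
proof -
  obtain S :: "'a set" where S: "finite S" "gen_subfield S = UNIV" using fg by (auto simp: fg_field_def)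
  have "\<exists>W. finite W \<and> spans_subring E W \<and> S \<subseteq> span_over E W" using S(1)
  proof (induction S rule: finite_induct)
    case empty
    have "1 \<in> span_over E {1}" by (rule span_over_generator) auto
    then show ?case by (intro exI[of _ "{1}"]) (simp add: spans_subring_def)
  next
    case (insert s S)
    then obtain W where W: "finite W" "spans_subring E W" "S \<subseteq> span_over E W" by blast
    then obtain W' where "finite W'" "spans_subring E W'" "span_over E W \<subseteq> span_over E W'" "s \<in> span_over E W'"
      using spans_subring_extend[OF W(1,2) alg] by blast
    then show ?case using W(3) by (intro exI[of _ W']) auto
  qed
  then obtain W where W: "finite W" "spans_subring E W" "S \<subseteq> span_over E W" by blast
  have "subfield (span_over E W)"
    unfolding subfield_def
  proof (intro conjI ballI)
    show "0 \<in> span_over E W" by (rule span_over_0)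
    show "1 \<in> span_over E W" using W(2) by (simp add: spans_subring_def)
    fix x assume x: "x \<in> span_over E W"
    show "- x \<in> span_over E W" by (rule span_over_uminus[OF x])
    show "inverse x \<in> span_over E W" by (rule span_over_inverse[OF W(1,2) x alg])
    fix y assume y: "y \<in> span_over E W"
    show "x + y \<in> span_over E W" by (rule span_over_add[OF x y])
    show "x * y \<in> span_over E W" by (rule span_over_mult[OF W(1,2) x y])
  qed
  then show ?thesis using gen_subfield_minimal[OF _ W(3)] S(2) W(1) by auto
qed

end

section \<open>Algebraic independence\<close>

lemma algebraic_overI_sum:
  assumes "\<forall>j\<le>n. P j \<in> A" "0 \<in> A" "j0 \<le> n" "P j0 \<noteq> 0" "(\<Sum>j\<le>n. P j * y ^ j) = 0"
  shows "algebraic_over A y"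
proof -
  define p where "p = (\<Sum>j\<le>n. monom (P j) j)"
  have coeff_p: "coeff p j = (if j \<le> n then P j else 0)" for j
    by (simp add: p_def coeff_sum coeff_monom)
  have "p \<noteq> 0" using assms(3,4) coeff_p[of j0] by auto
  moreover have "poly_over A p" using assms(1,2) by (simp add: poly_over_def coeff_p)
  moreover have "poly p y = 0" using assms(5) by (simp add: p_def poly_sum poly_monom)
  ultimately show ?thesis by (auto simp: algebraic_over_iff)
qed

definition eval_monomial :: "'a::comm_ring_1 list \<Rightarrow> (nat \<Rightarrow> nat) \<Rightarrow> 'a" where
  "eval_monomial xs \<alpha> = (\<Prod>i<length xs. xs ! i ^ \<alpha> i)"

lemma alg_indep_iff: "alg_indep k xs \<longleftrightarrow>
     (\<forall>c. finite {\<alpha>. c \<alpha> \<noteq> 0} \<and> (\<forall>\<alpha>. c \<alpha> \<in> k) \<and>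
        (\<forall>\<alpha>. c \<alpha> \<noteq> 0 \<longrightarrow> (\<forall>i\<ge>length xs. \<alpha> i = 0)) \<and>
        (\<Sum>\<alpha>\<in>{\<alpha>. c \<alpha> \<noteq> 0}. c \<alpha> * eval_monomial xs \<alpha>) = 0 \<longrightarrow> (\<forall>\<alpha>. c \<alpha> = 0))"
  by (simp add: alg_indep_def eval_monomial_def)

lemma eval_monomial_snoc: "eval_monomial (xs @ [y]) \<alpha> = eval_monomial xs \<alpha> * y ^ \<alpha> (length xs)"
proof -
  have "(\<Prod>i<length xs. (xs @ [y]) ! i ^ \<alpha> i) = eval_monomial xs \<alpha>"
    unfolding eval_monomial_def by (rule prod.cong) (auto simp: nth_append)
  then show ?thesis by (simp add: eval_monomial_def)
qed

text \<open>Exponent vectors only matter below \<open>length xs\<close>; a relation may be indexed by any family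
  of exponent vectors that stay distinct after truncation to that range.\<close>

lemma alg_indepD:
  assumes indep: "alg_indep k xs" and k: "subfield k"
    and A: "finite A" "\<forall>\<alpha>\<in>A. c \<alpha> \<in> k"
    and inj: "inj_on (\<lambda>\<alpha> i. if i < length xs then \<alpha> i else 0) A"
    and rel: "(\<Sum>\<alpha>\<in>A. c \<alpha> * eval_monomial xs \<alpha>) = 0"
  shows "\<forall>\<alpha>\<in>A. c \<alpha> = 0"
proof -
  define trunc :: "(nat \<Rightarrow> nat) \<Rightarrow> nat \<Rightarrow> nat" where
    "trunc = (\<lambda>\<alpha> i. if i < length xs then \<alpha> i else 0)"
  note inj = inj[folded trunc_def]
  define c' where "c' \<beta> = (if \<beta> \<in> trunc ` A then c (the_inv_into A trunc \<beta>) else 0)" for \<beta>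
  have c'_trunc: "c' (trunc \<alpha>) = c \<alpha>" if "\<alpha> \<in> A" for \<alpha>
    using that inj by (simp add: c'_def the_inv_into_f_f)
  have mon_trunc: "eval_monomial xs (trunc \<alpha>) = eval_monomial xs \<alpha>" for \<alpha>
    by (simp add: eval_monomial_def trunc_def)
  have supp: "{\<beta>. c' \<beta> \<noteq> 0} \<subseteq> trunc ` A" unfolding c'_def by auto
  have "(\<Sum>\<beta>\<in>{\<beta>. c' \<beta> \<noteq> 0}. c' \<beta> * eval_monomial xs \<beta>) = (\<Sum>\<beta>\<in>trunc ` A. c' \<beta> * eval_monomial xs \<beta>)"
    using A(1) supp by (intro sum.mono_neutral_left) auto
  also have "\<dots> = (\<Sum>\<alpha>\<in>A. c \<alpha> * eval_monomial xs \<alpha>)"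
    using inj by (simp add: sum.reindex c'_trunc mon_trunc)
  finally have "(\<Sum>\<beta>\<in>{\<beta>. c' \<beta> \<noteq> 0}. c' \<beta> * eval_monomial xs \<beta>) = 0" using rel by simp
  moreover have "finite {\<beta>. c' \<beta> \<noteq> 0}" using A(1) supp finite_subset by blast
  moreover have "c' \<beta> \<in> k" for \<beta>
    using A(2) subfield_0[OF k] the_inv_into_into[OF inj _ subset_refl] unfolding c'_def by auto
  moreover have "\<beta> i = 0" if "c' \<beta> \<noteq> 0" "i \<ge> length xs" for \<beta> i
    using that supp by (auto simp: trunc_def)
  ultimately have "\<forall>\<beta>. c' \<beta> = 0" using indep unfolding alg_indep_iff by blast
  then show ?thesis using c'_trunc by metis
qed

lemma alg_indep_Cons_nonzero:
  assumes k: "subfield k" and indep: "alg_indep k (f # ts)"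
  shows "f \<noteq> 0" "1 + f \<noteq> 0"
proof -
  define trunc :: "(nat \<Rightarrow> nat) \<Rightarrow> nat \<Rightarrow> nat" where
    "trunc = (\<lambda>\<alpha> i. if i < length (f # ts) then \<alpha> i else 0)"
  define e0 :: "nat \<Rightarrow> nat" where "e0 = (\<lambda>i. if i = 0 then 1 else 0)"
  have "eval_monomial (f # ts) e0 = (f # ts) ! 0 ^ e0 0 * (\<Prod>i<length ts. (f # ts) ! Suc i ^ e0 (Suc i))"
    unfolding eval_monomial_def by (simp only: length_Cons prod.lessThan_Suc_shift)
  then have mon_e0: "eval_monomial (f # ts) e0 = f" by (simp add: e0_def)
  have mon_0: "eval_monomial (f # ts) (\<lambda>_. 0) = 1" by (simp add: eval_monomial_def)
  have "trunc e0 0 \<noteq> trunc (\<lambda>_. 0) 0" by (simp add: trunc_def e0_def)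
  then have distinct: "trunc e0 \<noteq> trunc (\<lambda>_. 0)" "e0 \<noteq> (\<lambda>_. 0)" by auto
  then have inj: "inj_on trunc {e0, \<lambda>_. 0}" by (simp add: inj_on_def)
  show "f \<noteq> 0"
  proof
    assume "f = 0"
    then have "\<forall>\<alpha>\<in>{e0}. (1 :: 'a) = 0"
      using mon_e0 subfield_1[OF k] by (intro alg_indepD[OF indep k]) (auto simp: trunc_def)
    then show False by (metis insertI1 zero_neq_one)
  qed
  show "1 + f \<noteq> 0"
  proof
    assume "1 + f = 0"
    then have "\<forall>\<alpha>\<in>{e0, \<lambda>_. 0}. (1 :: 'a) = 0"
      using mon_e0 mon_0 subfield_1[OF k] inj distinct(2) unfolding trunc_def
      by (intro alg_indepD[OF indep k]) (auto simp: add.commute)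
    then show False by (metis insertI1 zero_neq_one)
  qed
qed

lemma alg_indep_fibre_sum_nonzero:
  assumes indep: "alg_indep k xs" and k: "subfield k"
    and Sp: "finite Sp" "\<forall>\<alpha>\<in>Sp. c \<alpha> \<in> k \<and> c \<alpha> \<noteq> 0" "\<forall>\<alpha>\<in>Sp. \<forall>i>length xs. \<alpha> i = 0"
    and \<alpha>0: "\<alpha>0 \<in> Sp"
  shows "(\<Sum>\<alpha>\<in>{\<alpha>\<in>Sp. \<alpha> (length xs) = \<alpha>0 (length xs)}. c \<alpha> * eval_monomial xs \<alpha>) \<noteq> 0"
    (is "(\<Sum>\<alpha>\<in>?A. _) \<noteq> 0")
proof
  assume rel: "(\<Sum>\<alpha>\<in>?A. c \<alpha> * eval_monomial xs \<alpha>) = 0"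
  have inj: "inj_on (\<lambda>\<alpha> i. if i < length xs then \<alpha> i else 0) ?A"
  proof (rule inj_onI)
    fix \<alpha> \<beta> assume \<alpha>\<beta>: "\<alpha> \<in> ?A" "\<beta> \<in> ?A"
      "(\<lambda>i. if i < length xs then \<alpha> i else 0) = (\<lambda>i. if i < length xs then \<beta> i else 0)"
    show "\<alpha> = \<beta>"
    proof
      fix i
      consider "i < length xs" | "i = length xs" | "length xs < i" by linarith
      then show "\<alpha> i = \<beta> i"
      proof cases
        case 1
        then show ?thesis using fun_cong[OF \<alpha>\<beta>(3), of i] by simp
      next
        case 3
        then show ?thesis using \<alpha>\<beta>(1,2) bspec[OF Sp(3), of \<alpha>] bspec[OF Sp(3), of \<beta>] by simp
      qed (use \<alpha>\<beta> in simp)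
    qed
  qed
  have "finite ?A" "\<forall>\<alpha>\<in>?A. c \<alpha> \<in> k" using Sp(1,2) by auto
  then have "\<forall>\<alpha>\<in>?A. c \<alpha> = 0" using alg_indepD[OF indep k _ _ inj rel] by blast
  then show False using \<alpha>0 Sp(2) by auto
qed

lemma algebraic_over_adjoin_if_dependent:
  assumes F: "subfield F" and k: "subfield k" "k \<subseteq> F" and ts: "set ts \<subseteq> F"
    and indep: "alg_indep k (f # ts)" and dep: "\<not> alg_indep k ((f # ts) @ [y])"
  shows "algebraic_over (adjoin_ring F f) y"
proof -
  define xs where "xs = f # ts"
  define m where "m = length xs"
  obtain c where c: "finite {\<alpha>. c \<alpha> \<noteq> 0}" "\<forall>\<alpha>. c \<alpha> \<in> k" "\<forall>\<alpha>. c \<alpha> \<noteq> 0 \<longrightarrow> (\<forall>i>m. \<alpha> i = 0)"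
    "(\<Sum>\<alpha>\<in>{\<alpha>. c \<alpha> \<noteq> 0}. c \<alpha> * (eval_monomial xs \<alpha> * y ^ \<alpha> m)) = 0" "\<not> (\<forall>\<alpha>. c \<alpha> = 0)"
    using dep unfolding alg_indep_iff eval_monomial_snoc xs_def[symmetric] m_def[symmetric]
    by (auto simp: m_def Suc_le_eq)
  define Sp where "Sp = {\<alpha>. c \<alpha> \<noteq> 0}"
  obtain \<alpha>0 where \<alpha>0: "\<alpha>0 \<in> Sp" using c(5) by (auto simp: Sp_def)
  define n where "n = Max ((\<lambda>\<alpha>. \<alpha> m) ` Sp)"
  have le_n: "\<alpha> m \<le> n" if "\<alpha> \<in> Sp" for \<alpha> unfolding n_def using c(1) that by (auto simp: Sp_def)
  define P where "P j = (\<Sum>\<alpha>\<in>{\<alpha>\<in>Sp. \<alpha> m = j}. c \<alpha> * eval_monomial xs \<alpha>)" for j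
  have "(\<Sum>j\<le>n. P j * y ^ j) = (\<Sum>j\<le>n. \<Sum>\<alpha>\<in>{\<alpha>\<in>Sp. \<alpha> m = j}. c \<alpha> * (eval_monomial xs \<alpha> * y ^ \<alpha> m))"
    by (simp add: P_def sum_distrib_right mult.assoc)
  also have "\<dots> = (\<Sum>\<alpha>\<in>Sp. c \<alpha> * (eval_monomial xs \<alpha> * y ^ \<alpha> m))"
    using c(1) le_n by (intro sum.group) (auto simp: Sp_def)
  also have "\<dots> = 0" using c(4) by (simp add: Sp_def)
  finally have rel: "(\<Sum>j\<le>n. P j * y ^ j) = 0" .
  have "xs ! i \<in> adjoin_ring F f" if "i < m" for i
    using that subsetD[OF ts nth_mem] adjoin_ring_generator[OF F] adjoin_ring_const[OF F]
    by (cases i) (auto simp: xs_def m_def)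
  then have "eval_monomial xs \<alpha> \<in> adjoin_ring F f" for \<alpha>
    unfolding eval_monomial_def m_def[symmetric] by (intro adjoin_ring_prod[OF F] adjoin_ring_power[OF F]) auto
  moreover have "c \<alpha> \<in> adjoin_ring F f" for \<alpha> using c(2) k(2) adjoin_ring_const[OF F] by blast
  ultimately have "P j \<in> adjoin_ring F f" for j
    unfolding P_def by (intro adjoin_ring_sum[OF F] adjoin_ring_mult[OF F])
  moreover have "P (\<alpha>0 m) \<noteq> 0"
  proof -
    have "finite Sp" "\<forall>\<alpha>\<in>Sp. c \<alpha> \<in> k \<and> c \<alpha> \<noteq> 0" "\<forall>\<alpha>\<in>Sp. \<forall>i>length xs. \<alpha> i = 0"
      using c(1,2,3) by (auto simp: Sp_def m_def)
    from alg_indep_fibre_sum_nonzero[OF _ k(1) this \<alpha>0] indep show ?thesis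
      by (simp add: P_def m_def xs_def)
  qed
  ultimately show ?thesis
    using rel le_n[OF \<alpha>0] adjoin_ring_const[OF F subfield_0[OF F]]
    by (intro algebraic_overI_sum[of n P]) auto
qed

section \<open>The sets \<open>\<Theta>\<close> and \<open>\<Theta>\<close>-bar\<close>

lemma Dset_valuation_ring: "V \<in> Dset F f \<Longrightarrow> valuation_ring V"
  by (simp add: Dset_def curve_points_def)

lemma Theta_bar_subset_max_ideal:
  assumes y: "y \<in> Theta_bar F f" and V: "V \<in> Dset F f"
  shows "y \<in> max_ideal V"
proof (rule ccontr)
  assume y_notin: "y \<notin> max_ideal V"
  note vr = Dset_valuation_ring[OF V]
  have y0: "y \<noteq> 0" "inverse y \<notin> Theta F f" "inverse y - 1 \<notin> Theta F f"
    using y by (auto simp: Theta_bar_def)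
  have unit_in_Theta: "u \<in> Theta F f" if "u \<in> vr_units V" for u
  proof -
    have "u \<in> unit_squares V" unfolding unit_squares_def using that by (intro CollectI exI[of _ u] exI[of _ 1]) simp
    then show ?thesis using V by (auto simp: Theta_def)
  qed
  show False
  proof (cases "y \<in> V")
    case True
    then have "inverse y \<in> vr_units V" using y_notin vr_mem_cases[OF vr] vr_units_inverse[OF vr] by blast
    then show False using y0 unit_in_Theta by blast
  next
    case False
    then have "inverse y \<in> max_ideal V" using vr_total[OF vr y0(1)] by (simp add: max_ideal_iff[OF vr])
    then have "- 1 + inverse y \<in> vr_units V"
      using vr_units_add_max_ideal[OF vr vr_units_uminus[OF vr vr_units_1[OF vr]]] by blast
    then show False using y0 unit_in_Theta by simp
  qed
qed

lemma val_evenI: "g \<noteq> 0 \<Longrightarrow> y * g ^ 2 \<in> vr_units V \<Longrightarrow> val_even V y"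
  unfolding val_even_def by (intro exI[of _ "inverse g"]) (simp add: power_inverse)

lemma Theta_barI:
  assumes y: "y \<noteq> 0" and odd: "\<forall>V\<in>Dset F f. y \<in> max_ideal V \<and> \<not> val_even V y"
  shows "y \<in> Theta_bar F f"
proof -
  have "inverse y \<notin> unit_squares V \<and> inverse y - 1 \<notin> unit_squares V" if V: "V \<in> Dset F f" for V
  proof -
    note vr = Dset_valuation_ring[OF V]
    have not_unit: "y * g ^ 2 \<notin> vr_units V" if "g \<noteq> 0" for g
      using val_evenI[OF that] odd V by blast
    have one_minus_y: "1 + - y \<in> vr_units V"
      using odd V vr_units_add_max_ideal[OF vr vr_units_1[OF vr] max_ideal_uminus[OF vr]] by blast
    have "inverse y \<noteq> u * g ^ 2" if u: "u \<in> vr_units V" and g: "g \<noteq> 0" for u g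
    proof
      assume "inverse y = u * g ^ 2"
      then have "y * g ^ 2 = inverse u" using y by (cases "u = 0") (auto simp: field_simps)
      then show False using not_unit[OF g] vr_units_inverse[OF vr u] by simp
    qed
    moreover have "inverse y - 1 \<noteq> u * g ^ 2" if u: "u \<in> vr_units V" and g: "g \<noteq> 0" for u g
    proof
      assume "inverse y - 1 = u * g ^ 2"
      then have "y * g ^ 2 = (1 + - y) / u" using y vr_units_nonzero[OF vr u] by (auto simp: field_simps)
      then show False using not_unit[OF g] vr_units_divide[OF vr one_minus_y u] by simp
    qed
    ultimately show ?thesis unfolding unit_squares_def by blast
  qed
  then show ?thesis using y by (auto simp: Theta_bar_def Theta_def)
qed

lemma set_diff_Theta_bar_subset: "set_diff (Theta_bar F f) (Theta_bar F f) \<subseteq> ideal_a F f"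
proof
  fix x assume "x \<in> set_diff (Theta_bar F f) (Theta_bar F f)"
  then obtain a b where ab: "x = a - b" "a \<in> Theta_bar F f" "b \<in> Theta_bar F f"
    by (auto simp: set_diff_def)
  moreover have "a - b \<in> max_ideal V" if V: "V \<in> Dset F f" for V
    using Theta_bar_subset_max_ideal[OF _ V] max_ideal_diff[OF Dset_valuation_ring[OF V]] ab by blast
  ultimately show "x \<in> ideal_a F f" by (simp add: ideal_a_def)
qed

lemma multipliers_of_ideal_a:
  assumes r: "r \<in> ring_R F f"
  shows "\<forall>x\<in>ideal_a F f. r * x \<in> ideal_a F f"
  using r by (auto simp: ring_R_def ideal_a_def intro!: max_ideal_mult[OF Dset_valuation_ring])

lemma Theta_bar_if_Dset_empty: "Dset F f = {} \<Longrightarrow> Theta_bar F f = {y. y \<noteq> 0}"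
  by (auto simp: Theta_bar_def Theta_def)

section \<open>Rational valuations on a function field\<close>

lemma exists_nat_mult_greater:
  assumes "finite T" "\<forall>W\<in>T. a W > (0 :: rat)"
  shows "\<exists>N > 0. \<forall>W\<in>T. b W < of_nat N * a W"
proof -
  have "\<forall>\<^sub>F N in sequentially. b W < of_nat N * a W" if W: "W \<in> T" for W
  proof -
    obtain N0 where N0: "b W < of_nat N0 * a W" using ex_less_of_nat_mult assms(2) W by blast
    show ?thesis
    proof (rule eventually_sequentiallyI[of N0])
      fix N assume "N0 \<le> N"
      then have "of_nat N0 * a W \<le> of_nat N * a W" using assms(2) W by (simp add: mult_right_mono)
      then show "b W < of_nat N * a W" using N0 by linarith
    qed
  qed
  then have "\<forall>\<^sub>F N in sequentially. N > 0 \<and> (\<forall>W\<in>T. b W < of_nat N * a W)"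
    using assms(1) by (intro eventually_conj eventually_gt_at_top eventually_ball_finite) auto
  then show ?thesis by (auto simp: eventually_sequentially)
qed

locale algebraic_function_field =
  fixes F :: "'a::field set" and f :: 'a
  assumes subfield_F: "subfield F"
    and f_nonzero: "f \<noteq> 0" and one_plus_f_nonzero: "1 + f \<noteq> 0"
    and algebraic: "\<And>y. algebraic_over (adjoin_ring F f) y"
    and finitely_generated: "fg_field (UNIV :: 'a set)"
begin

text \<open>\<open>h\<close> is positive exactly at the zeros and at the poles of \<open>f\<close>, so the places of
  \<open>h_places\<close> are those where \<open>f\<close> is not a unit; every valuation is normalised by \<open>v(h) = 1\<close>.\<close>

definition h :: 'a where "h = f / (1 + f) ^ 2"

definition h_places :: "'a set set" where
  "h_places = {V. valuation_ring V \<and> F \<subseteq> V \<and> h \<in> max_ideal V}"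

lemma h_nonzero: "h \<noteq> 0"
  using f_nonzero one_plus_f_nonzero by (simp add: h_def)

lemma h_placesD:
  assumes "V \<in> h_places"
  shows "valuation_ring V" "F \<subseteq> V" "h \<in> max_ideal V"
  using assms by (auto simp: h_places_def)

lemma inverse_h_notin: "V \<in> h_places \<Longrightarrow> inverse h \<notin> V"
  using h_placesD[of V] max_ideal_iff h_nonzero by blast

lemma h_power_max_ideal: "V \<in> h_places \<Longrightarrow> m > 0 \<Longrightarrow> h ^ m \<in> max_ideal V"
  using h_placesD[of V] max_ideal_mult[of V "h ^ (m - 1)" h] vr_power[of V h "m - 1"]
  by (cases m) (auto simp: max_ideal_iff mult.commute)

lemma h_power_int_unit:
  assumes V: "V \<in> h_places" and u: "h powi j \<in> vr_units V"
  shows "j = 0"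
proof -
  note vr = h_placesD(1)[OF V]
  have False if "h powi i \<in> vr_units V" "i > 0" for i
    using that h_power_max_ideal[OF V, of "nat i"] max_ideal_not_unit[OF vr] by (simp add: power_int_def)
  moreover have "h powi (- j) \<in> vr_units V"
    using vr_units_inverse[OF vr u] by (simp add: power_int_minus)
  ultimately show ?thesis using u by (metis neg_0_less_iff_less linorder_neqE)
qed

lemma zero_of_f:
  assumes V: "V \<in> h_places" and fV: "f \<in> V"
  shows "f \<in> max_ideal V" "f / h \<in> vr_units V"
proof -
  note vr = h_placesD(1)[OF V]
  have sq: "f / h = (1 + f) ^ 2" using one_plus_f_nonzero f_nonzero by (simp add: h_def field_simps)
  show fm: "f \<in> max_ideal V"
  proof (rule ccontr)
    assume "f \<notin> max_ideal V"
    then have "inverse f \<in> V" using vr_mem_cases[OF vr fV] by (simp add: vr_units_iff[OF vr])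
    moreover have "f / h \<in> V" using sq fV vr_1[OF vr] vr_add[OF vr] vr_power[OF vr] by metis
    ultimately have "inverse f * (f / h) \<in> V" using vr_mult[OF vr] by blast
    moreover have "inverse f * (f / h) = inverse h" using f_nonzero by (simp add: field_simps)
    ultimately show False using inverse_h_notin[OF V] by simp
  qed
  have "1 + f \<in> vr_units V" using vr_units_add_max_ideal[OF vr vr_units_1[OF vr] fm] .
  then show "f / h \<in> vr_units V" using sq vr_units_power[OF vr] by simp
qed

lemma pole_of_f:
  assumes V: "V \<in> h_places" and fV: "f \<notin> V"
  shows "inverse f \<in> max_ideal V" "f * h \<in> vr_units V"
proof -
  note vr = h_placesD(1)[OF V]
  show im: "inverse f \<in> max_ideal V"
    using vr_total[OF vr f_nonzero] fV by (simp add: max_ideal_iff[OF vr])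
  have "1 + inverse f \<in> vr_units V" using vr_units_add_max_ideal[OF vr vr_units_1[OF vr] im] .
  moreover have "f * h = inverse ((1 + inverse f) ^ 2)"
    using one_plus_f_nonzero f_nonzero by (simp add: h_def field_simps power2_eq_square)
  ultimately show "f * h \<in> vr_units V" using vr_units_inverse[OF vr] vr_units_power[OF vr] by simp
qed

text \<open>Elements of \<open>F[f]\<close> have integral value, and the same one at all zeros (resp. all poles) of \<open>f\<close>:
  it is the order of vanishing at \<open>0\<close> (resp. minus the degree) of the polynomial.\<close>

lemma adjoin_ring_val_at_zeros:
  assumes "a \<in> adjoin_ring F f" "a \<noteq> 0"
  shows "\<exists>k. \<forall>V\<in>h_places. f \<in> V \<longrightarrow> a * h powi (- k) \<in> vr_units V"
proof -
  obtain p where p: "poly_over F p" "a = poly p f" using assms(1) by (rule adjoin_ringE)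
  then obtain m q where mq: "poly_over F q" "coeff q 0 \<noteq> 0" "\<forall>x. poly p x = x ^ m * poly q x"
    using poly_over_factor_power assms(2) by fastforce
  have "a * h powi (- int m) \<in> vr_units V" if V: "V \<in> h_places" and fV: "f \<in> V" for V
  proof -
    note vr = h_placesD(1)[OF V]
    have "poly q f \<in> vr_units V"
      using poly_over_unit[OF vr subfield_F h_placesD(2)[OF V] mq(1,2) zero_of_f(1)[OF V fV]] .
    moreover have "a * h powi (- int m) = (f / h) ^ m * poly q f"
      using p(2) mq(3) h_nonzero by (simp add: power_int_minus power_divide field_simps)
    ultimately show ?thesis using vr_units_mult[OF vr vr_units_power[OF vr zero_of_f(2)[OF V fV]]] by simp
  qed
  then show ?thesis by blast
qed

lemma adjoin_ring_val_at_poles: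
  assumes "a \<in> adjoin_ring F f" "a \<noteq> 0"
  shows "\<exists>k. \<forall>V\<in>h_places. f \<notin> V \<longrightarrow> a * h powi (- k) \<in> vr_units V"
proof -
  obtain p where p: "poly_over F p" "a = poly p f" using assms(1) by (rule adjoin_ringE)
  let ?q = "reflect_poly p"
  have "p \<noteq> 0" using p assms(2) by auto
  then have q: "poly_over F ?q" "coeff ?q 0 \<noteq> 0"
    using poly_over_reflect[OF subfield_F p(1)] by (auto simp: coeff_reflect_poly)
  have "a * h powi (- (- int (degree p))) \<in> vr_units V" if V: "V \<in> h_places" and fV: "f \<notin> V" for V
  proof -
    note vr = h_placesD(1)[OF V]
    have "poly ?q (inverse f) \<in> vr_units V"
      using poly_over_unit[OF vr subfield_F h_placesD(2)[OF V] q pole_of_f(1)[OF V fV]] .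
    moreover have "a * h powi (- (- int (degree p))) = (f * h) ^ degree p * poly ?q (inverse f)"
      using p(2) poly_reflect_poly_nz[of "inverse f" p] f_nonzero
      by (simp add: power_mult_distrib power_inverse field_simps)
    ultimately show ?thesis using vr_units_mult[OF vr vr_units_power[OF vr pole_of_f(2)[OF V fV]]] by simp
  qed
  then show ?thesis by blast
qed

lemma adjoin_ring_val:
  assumes "a \<in> adjoin_ring F f" "a \<noteq> 0" "V \<in> h_places"
  shows "\<exists>k. a * h powi (- k) \<in> vr_units V"
  using adjoin_ring_val_at_zeros[OF assms(1,2)] adjoin_ring_val_at_poles[OF assms(1,2)] assms(3) by blast

text \<open>Since \<open>y\<close> is algebraic over \<open>F[f]\<close>, two terms of a vanishing relation have equal value,
  which pins down a rational value of \<open>y\<close>.\<close>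

lemma exists_val_rep:
  assumes V: "V \<in> h_places" and y: "y \<noteq> 0"
  shows "\<exists>N k. N > 0 \<and> y ^ N * h powi (- k) \<in> vr_units V"
proof -
  note vr = h_placesD(1)[OF V]
  obtain p where p: "p \<noteq> 0" "poly_over (adjoin_ring F f) p" "poly p y = 0"
    using algebraic[of y] by (auto simp: algebraic_over_iff)
  define J where "J = {j. j \<le> degree p \<and> coeff p j \<noteq> 0}"
  define T where "T j = coeff p j * y ^ j" for j
  have J: "finite J" "J \<noteq> {}" using p(1) by (auto simp: J_def intro!: exI[of _ "degree p"])
  have T: "\<forall>j\<in>J. T j \<noteq> 0" using y by (auto simp: J_def T_def)
  have "sum T J = poly p y"
    unfolding poly_altdef T_def by (rule sum.mono_neutral_left) (auto simp: J_def)
  then obtain i j where ij: "i \<in> J" "j \<in> J" "i \<noteq> j" "T j / T i \<in> vr_units V"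
    using vr_vanishing_sum[OF vr J T] p(3) by auto
  have "\<forall>l\<in>J. \<exists>k. coeff p l * h powi (- k) \<in> vr_units V"
    using adjoin_ring_val p(2) V by (auto simp: J_def poly_over_def)
  then obtain kk where kk: "\<forall>l\<in>J. coeff p l * h powi (- kk l) \<in> vr_units V" by metis
  have "T j / T i * ((coeff p i * h powi (- kk i)) / (coeff p j * h powi (- kk j)))
      = y ^ j / y ^ i * h powi (kk j - kk i)"
    using ij(1,2) y h_nonzero by (simp add: J_def T_def field_simps power_int_diff power_int_minus)
  then have U: "y ^ j / y ^ i * h powi (kk j - kk i) \<in> vr_units V"
    using vr_units_mult[OF vr ij(4) vr_units_divide[OF vr]] kk ij(1,2) by metis
  show ?thesis
  proof (cases "i < j")
    case True
    then have "y ^ j / y ^ i = y ^ (j - i)" using y by (simp add: power_diff)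
    then show ?thesis using U True by (intro exI[of _ "j - i"] exI[of _ "kk i - kk j"]) auto
  next
    case False
    then have "y ^ j / y ^ i = inverse (y ^ (i - j))" using ij(3) y by (simp add: power_diff power_inverse)
    then have "inverse (y ^ (i - j) * h powi (kk i - kk j)) \<in> vr_units V"
      using U h_nonzero by (simp add: power_int_diff field_simps)
    then have "y ^ (i - j) * h powi (kk i - kk j) \<in> vr_units V" using vr_units_inverse[OF vr] by fastforce
    then show ?thesis using False ij(3) by (intro exI[of _ "i - j"] exI[of _ "kk j - kk i"]) auto
  qed
qed

text \<open>\<open>val V y = k/N\<close> whenever \<open>y\<^sup>N/h\<^sup>k\<close> is a unit of \<open>V\<close>; this is well defined on \<open>K\<^sup>\<times>\<close> by
  \<open>val_rep_unique\<close> and \<open>exists_val_rep\<close>, while \<open>val V 0\<close> is an unspecified junk value.\<close>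

definition val :: "'a set \<Rightarrow> 'a \<Rightarrow> rat" where
  "val V y = (SOME q. \<exists>N k. N > 0 \<and> q = of_int k / of_nat N \<and> y ^ N * h powi (- k) \<in> vr_units V)"

lemma val_rep_power: "(y ^ N * h powi (- k)) ^ M = y ^ (N * M) * h powi (- (k * int M))"
  by (simp add: power_mult_distrib power_int_power' power_mult)

lemma val_rep_unique:
  assumes V: "V \<in> h_places" and N: "N > 0" "M > 0"
    and u1: "y ^ N * h powi (- k) \<in> vr_units V" and u2: "y ^ M * h powi (- l) \<in> vr_units V"
  shows "(of_int k / of_nat N :: rat) = of_int l / of_nat M"
proof -
  note vr = h_placesD(1)[OF V]
  have y: "y \<noteq> 0" using vr_units_nonzero[OF vr u1] N by auto
  have a: "y ^ (N * M) * h powi (- (k * int M)) \<in> vr_units V"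
    using vr_units_power[OF vr u1, of M] val_rep_power by metis
  have b: "y ^ (M * N) * h powi (- (l * int N)) \<in> vr_units V"
    using vr_units_power[OF vr u2, of N] val_rep_power by metis
  have yNM: "y ^ (M * N) \<noteq> 0" using y by simp
  have "(y ^ (N * M) * h powi (- (k * int M))) / (y ^ (M * N) * h powi (- (l * int N)))
        = h powi (- (k * int M)) / h powi (- (l * int N))"
    using yNM y N by (simp add: mult.commute[of N M])
  also have "\<dots> = h powi (- (k * int M) - - (l * int N))"
    using h_nonzero power_int_diff[of h "- (k * int M)" "- (l * int N)"] by simp
  finally have "h powi (- (k * int M) - - (l * int N)) \<in> vr_units V"
    using vr_units_divide[OF vr a b] by simp
  then have "- (k * int M) - - (l * int N) = 0" using h_power_int_unit[OF V] by blast
  then have "k * int M = l * int N" by simp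
  then have "(of_int k * of_nat M :: rat) = of_int l * of_nat N"
    by (metis of_int_mult of_int_of_nat_eq)
  then show ?thesis using N by (simp add: field_simps)
qed

lemma val_eq:
  assumes V: "V \<in> h_places" and N: "N > 0" and u: "y ^ N * h powi (- k) \<in> vr_units V"
  shows "val V y = of_int k / of_nat N"
proof -
  let ?P = "\<lambda>q. \<exists>N k. N > 0 \<and> q = of_int k / of_nat N \<and> y ^ N * h powi (- k) \<in> vr_units V"
  have "?P (of_int k / of_nat N)" using N u by blast
  then have "?P (val V y)" unfolding val_def by (rule someI)
  then obtain N' k' where "N' > 0" "val V y = of_int k' / of_nat N'" "y ^ N' * h powi (- k') \<in> vr_units V"
    by blast
  then show ?thesis using val_rep_unique[OF V N _ u] by metis
qed

lemma val_repE:
  assumes V: "V \<in> h_places" and y: "y \<noteq> 0"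
  obtains N k where "N > 0" "y ^ N * h powi (- k) \<in> vr_units V" "val V y = of_int k / of_nat N"
  using exists_val_rep[OF V y] val_eq[OF V] by blast

lemma val_mult:
  assumes V: "V \<in> h_places" and y: "y \<noteq> 0" and z: "z \<noteq> 0"
  shows "val V (y * z) = val V y + val V z"
proof -
  note vr = h_placesD(1)[OF V]
  obtain N k where 1: "N > 0" "y ^ N * h powi (- k) \<in> vr_units V" "val V y = of_int k / of_nat N"
    using val_repE[OF V y] by blast
  obtain M l where 2: "M > 0" "z ^ M * h powi (- l) \<in> vr_units V" "val V z = of_int l / of_nat M"
    using val_repE[OF V z] by blast
  have "(y ^ N * h powi (- k)) ^ M * (z ^ M * h powi (- l)) ^ N
      = (y * z) ^ (N * M) * (h powi (- (k * int M)) * h powi (- (l * int N)))"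
    unfolding val_rep_power by (simp add: power_mult_distrib mult.commute mult.left_commute)
  also have "\<dots> = (y * z) ^ (N * M) * h powi (- (k * int M + l * int N))"
    using h_nonzero by (simp add: power_int_add[symmetric])
  finally have U: "(y * z) ^ (N * M) * h powi (- (k * int M + l * int N)) \<in> vr_units V"
    using vr_units_mult[OF vr vr_units_power[OF vr 1(2)] vr_units_power[OF vr 2(2)]] by metis
  have "val V (y * z) = of_int (k * int M + l * int N) / of_nat (N * M)"
    by (rule val_eq[OF V _ U]) (use 1(1) 2(1) in simp)
  also have "\<dots> = val V y + val V z" using 1 2 by (simp add: field_simps)
  finally show ?thesis .
qed

lemma val_inverse:
  assumes V: "V \<in> h_places" and y: "y \<noteq> 0"
  shows "val V (inverse y) = - val V y"
proof -
  note vr = h_placesD(1)[OF V]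
  obtain N k where 1: "N > 0" "y ^ N * h powi (- k) \<in> vr_units V" "val V y = of_int k / of_nat N"
    using val_repE[OF V y] by blast
  have "inverse y ^ N * h powi (- (- k)) = inverse (y ^ N * h powi (- k))"
    by (simp add: power_inverse power_int_minus)
  then have "inverse y ^ N * h powi (- (- k)) \<in> vr_units V" using vr_units_inverse[OF vr 1(2)] by simp
  then have "val V (inverse y) = of_int (- k) / of_nat N" using val_eq[OF V 1(1)] by blast
  then show ?thesis using 1 by simp
qed

lemma val_unit: assumes V: "V \<in> h_places" and u: "u \<in> vr_units V" shows "val V u = 0"
  using val_eq[OF V, of 1 u 0] u by simp

lemma val_h: assumes V: "V \<in> h_places" shows "val V h = 1"
  using val_eq[OF V, of 1 h 1] h_nonzero vr_units_1[OF h_placesD(1)[OF V]] by (simp add: power_int_minus)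

lemma val_nonneg_iff:
  assumes V: "V \<in> h_places" and y: "y \<noteq> 0"
  shows "y \<in> V \<longleftrightarrow> val V y \<ge> 0"
proof -
  note vr = h_placesD(1)[OF V]
  obtain N k where 1: "N > 0" "y ^ N * h powi (- k) \<in> vr_units V" "val V y = of_int k / of_nat N"
    using val_repE[OF V y] by blast
  show ?thesis
  proof (cases "k \<ge> 0")
    case True
    have "h powi (- k) * h ^ nat k = 1" using h_nonzero True by (simp add: power_int_minus power_int_nonneg_exp)
    then have "y ^ N = (y ^ N * h powi (- k)) * h ^ nat k" by (metis mult.assoc mult_1_right)
    then have "y ^ N \<in> V" using vr_units_mem[OF vr 1(2)] vr_mult[OF vr] vr_power[OF vr]
        h_placesD(3)[OF V] max_ideal_iff[OF vr] by metis
    then have "y \<in> V" using vr_mem_if_power_mem[OF vr] 1(1) by blast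
    moreover have "val V y \<ge> 0" using 1 True by simp
    ultimately show ?thesis by simp
  next
    case False
    have "val V y < 0" using 1 False by (simp add: divide_neg_pos)
    moreover have "y \<notin> V"
    proof
      assume "y \<in> V"
      then have yN: "y ^ N \<in> V" using vr_power[OF vr] by blast
      have e: "h powi (- k) = h ^ nat (- k)" using False by (simp add: power_int_nonneg_exp)
      have "h ^ nat (- k) \<in> max_ideal V" using h_power_max_ideal[OF V] False by simp
      then have "y ^ N * h ^ nat (- k) \<in> max_ideal V" using max_ideal_mult[OF vr yN] by blast
      then have "y ^ N * h powi (- k) \<in> max_ideal V" using e by simp
      then show False using max_ideal_not_unit[OF vr] 1(2) by blast
    qed
    ultimately show ?thesis by simp
  qed
qed

lemma val_zero_iff:
  assumes V: "V \<in> h_places" and y: "y \<noteq> 0"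
  shows "y \<in> vr_units V \<longleftrightarrow> val V y = 0"
proof -
  have iy: "inverse y \<noteq> 0" using y by simp
  have "y \<in> vr_units V \<longleftrightarrow> y \<in> V \<and> inverse y \<in> V" using vr_units_iff[OF h_placesD(1)[OF V]] y by simp
  also have "\<dots> \<longleftrightarrow> val V y \<ge> 0 \<and> val V (inverse y) \<ge> 0"
    using val_nonneg_iff[OF V y] val_nonneg_iff[OF V iy] by simp
  also have "\<dots> \<longleftrightarrow> val V y = 0" unfolding val_inverse[OF V y] by linarith
  finally show ?thesis .
qed

lemma val_pos_iff:
  assumes V: "V \<in> h_places" and y: "y \<noteq> 0"
  shows "y \<in> max_ideal V \<longleftrightarrow> val V y > 0"
proof -
  have "y \<in> max_ideal V \<longleftrightarrow> y \<in> V \<and> y \<notin> vr_units V" unfolding max_ideal_def by simp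
  also have "\<dots> \<longleftrightarrow> val V y \<ge> 0 \<and> val V y \<noteq> 0" using val_nonneg_iff[OF V y] val_zero_iff[OF V y] by simp
  finally show ?thesis by linarith
qed

lemma val_1: "V \<in> h_places \<Longrightarrow> val V 1 = 0"
  by (rule val_unit, assumption, rule vr_units_1, rule h_placesD(1))

lemma val_divide: "V \<in> h_places \<Longrightarrow> y \<noteq> 0 \<Longrightarrow> z \<noteq> 0 \<Longrightarrow> val V (y / z) = val V y - val V z"
  by (simp add: divide_inverse val_mult val_inverse)

lemma val_power: assumes V: "V \<in> h_places" and y: "y \<noteq> 0" shows "val V (y ^ n) = of_nat n * val V y"
proof (induction n)
  case 0 then show ?case using val_1[OF V] by simp
next
  case (Suc n)
  have "val V (y ^ Suc n) = val V y + val V (y ^ n)" using val_mult[OF V y, of "y ^ n"] y by simp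
  then show ?case using Suc by (simp add: algebra_simps)
qed

lemma val_powi: "V \<in> h_places \<Longrightarrow> y \<noteq> 0 \<Longrightarrow> val V (y powi k) = of_int k * val V y"
proof (cases "k \<ge> 0")
  case True
  assume V: "V \<in> h_places" and y: "y \<noteq> 0"
  have "y powi k = y ^ nat k" using True by (simp add: power_int_nonneg_exp)
  then show ?thesis using val_power[OF V y, of "nat k"] True by simp
next
  case False
  assume V: "V \<in> h_places" and y: "y \<noteq> 0"
  have "y powi k = inverse (y ^ nat (- k))" using False by (simp add: power_int_def power_inverse)
  then show ?thesis using val_power[OF V y, of "nat (- k)"] val_inverse[OF V, of "y ^ nat (- k)"] False y by simp
qed

lemma val_uminus: assumes V: "V \<in> h_places" shows "val V (- y) = val V y"
proof (cases "y = 0")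
  case True then show ?thesis by simp
next
  case False
  have "- y = (- 1) * y" by simp
  moreover have "val V (- 1) = 0" using val_unit[OF V] vr_units_uminus[OF h_placesD(1)[OF V] vr_units_1[OF h_placesD(1)[OF V]]] by simp
  ultimately show ?thesis using val_mult[OF V, of "-1" y] False by simp
qed

lemma val_add_ge:
  assumes V: "V \<in> h_places" and nz: "y \<noteq> 0" "z \<noteq> 0" "y + z \<noteq> 0"
  shows "val V (y + z) \<ge> min (val V y) (val V z)"
proof -
  note vr = h_placesD(1)[OF V]
  have main: "val V (a + b) \<ge> val V a" if ab: "a \<noteq> 0" "b \<noteq> 0" "a + b \<noteq> 0" "val V a \<le> val V b" for a b
  proof -
    have "val V (b / a) \<ge> 0" using val_divide[OF V ab(2) ab(1)] ab(4) by simp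
    then have "b / a \<in> V" using val_nonneg_iff[OF V] ab by simp
    then have "1 + b / a \<in> V" using vr_add[OF vr vr_1[OF vr]] by blast
    moreover have "1 + b / a \<noteq> 0" using ab by (simp add: field_simps)
    ultimately have "val V (1 + b / a) \<ge> 0" using val_nonneg_iff[OF V] by blast
    moreover have "a + b = a * (1 + b / a)" using ab by (simp add: field_simps)
    ultimately show ?thesis using val_mult[OF V ab(1) \<open>1 + b / a \<noteq> 0\<close>] by simp
  qed
  show ?thesis
  proof (cases "val V y \<le> val V z")
    case True then show ?thesis using main[of y z] nz by simp
  next
    case False then show ?thesis using main[of z y] nz by (simp add: add.commute)
  qed
qed

text \<open>\<open>val_ge V r y\<close> means \<open>v(y) \<ge> r\<close> with the convention \<open>v(0) = \<infinity>\<close>.\<close>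

definition val_ge :: "'a set \<Rightarrow> rat \<Rightarrow> 'a \<Rightarrow> bool" where
  "val_ge V r y \<longleftrightarrow> y = 0 \<or> r \<le> val V y"

lemma val_ge_0: "val_ge V r 0" by (simp add: val_ge_def)
lemma val_ge_self: "val_ge V (val V y) y" by (simp add: val_ge_def)
lemma val_ge_mono: "r' \<le> r \<Longrightarrow> val_ge V r y \<Longrightarrow> val_ge V r' y" by (auto simp: val_ge_def)

lemma val_ge_add: assumes V: "V \<in> h_places" "val_ge V r y" "val_ge V r z" shows "val_ge V r (y + z)"
proof -
  consider "y = 0" | "z = 0" | "y + z = 0" | "y \<noteq> 0" "z \<noteq> 0" "y + z \<noteq> 0" by blast
  then show ?thesis
  proof cases
    case 4
    then show ?thesis using val_add_ge[OF V(1) 4] V by (auto simp: val_ge_def)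
  qed (use V in \<open>auto simp: val_ge_def\<close>)
qed

lemma val_ge_sum: "V \<in> h_places \<Longrightarrow> (\<And>i. i \<in> I \<Longrightarrow> val_ge V r (g i)) \<Longrightarrow> val_ge V r (sum g I)"
  by (induction I rule: infinite_finite_induct) (auto simp: val_ge_0 val_ge_add)

lemma val_ge_mult: "V \<in> h_places \<Longrightarrow> val_ge V r y \<Longrightarrow> val_ge V s z \<Longrightarrow> val_ge V (r + s) (y * z)"
  by (cases "y = 0"; cases "z = 0") (auto simp: val_ge_def val_mult)

lemma val_add_dominated:
  assumes V: "V \<in> h_places" and t: "t \<noteq> 0" and y: "val_ge V r y" and r: "r > val V t"
  shows "t + y \<noteq> 0" "val V (t + y) = val V t"
proof -
  have "t + y \<noteq> 0 \<and> val V (t + y) = val V t"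
  proof (cases "y = 0")
    case True then show ?thesis using t by simp
  next
    case False
    then have yv: "val V y > val V t" using y r by (simp add: val_ge_def)
    have ty: "t + y \<noteq> 0"
    proof
      assume "t + y = 0"
      then have "y = - t" by (metis add.commute neg_eq_iff_add_eq_0)
      then show False using yv val_uminus[OF V] by simp
    qed
    have 1: "val V (t + y) \<ge> val V t" using val_add_ge[OF V t False ty] yv by simp
    have "t = (t + y) + (- y)" by simp
    then have "val V t \<ge> min (val V (t + y)) (val V (- y))"
      using val_add_ge[OF V ty, of "- y"] False t by simp
    moreover have "val V (- y) > val V t" using yv val_uminus[OF V] by simp
    ultimately have "val V t \<ge> val V (t + y)" by linarith
    then show ?thesis using 1 ty by simp
  qed
  then show "t + y \<noteq> 0" "val V (t + y) = val V t" by auto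
qed

section \<open>Weak approximation\<close>

lemma h_places_incomparable:
  assumes V: "V \<in> h_places" and W: "W \<in> h_places" and sub: "V \<subseteq> W"
  shows "V = W"
proof (rule ccontr)
  assume "V \<noteq> W"
  then obtain y where y: "y \<in> W" "y \<notin> V" using sub by blast
  note vrV = h_placesD(1)[OF V] and vrW = h_placesD(1)[OF W]
  have y0: "y \<noteq> 0" using y vr_0[OF vrV] by auto
  have yneg: "val V y < 0" using val_nonneg_iff[OF V y0] y by simp
  have "inverse h \<in> W"
  proof -
    let ?z = "inverse h"
    have z0: "?z \<noteq> 0" using h_nonzero by simp
    obtain N where N: "- val V ?z < of_nat N * (- val V y)"
      using ex_less_of_nat_mult[of "- val V y" "- val V ?z"] yneg by auto
    have yN: "y ^ N \<noteq> 0" using y0 by simp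
    have "val V (?z / y ^ N) = val V ?z - of_nat N * val V y"
      using val_divide[OF V z0 yN] val_power[OF V y0] by simp
    also have "\<dots> \<ge> 0" using N by (simp add: algebra_simps)
    finally have "?z / y ^ N \<in> V" using val_nonneg_iff[OF V] z0 yN by simp
    then have "?z / y ^ N \<in> W" using sub by blast
    moreover have "y ^ N \<in> W" using vr_power[OF vrW y(1)] .
    ultimately have "?z / y ^ N * y ^ N \<in> W" using vr_mult[OF vrW] by blast
    moreover have "?z / y ^ N * y ^ N = ?z" using yN by (metis divide_inverse mult.assoc left_inverse mult_1_right)
    ultimately show ?thesis by simp
  qed
  then show False using inverse_h_notin[OF W] by blast
qed

lemma exists_val_neg_pos:
  assumes V: "V \<in> h_places" and W: "W \<in> h_places" and ne: "V \<noteq> W"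
  shows "\<exists>y. y \<noteq> 0 \<and> val V y < 0 \<and> val W y > 0"
proof -
  have "\<not> W \<subseteq> V" using h_places_incomparable[OF W V] ne by blast
  then obtain b where b: "b \<in> W" "b \<notin> V" by blast
  have "\<not> V \<subseteq> W" using h_places_incomparable[OF V W] ne by blast
  then obtain a where a: "a \<in> V" "a \<notin> W" by blast
  have b0: "b \<noteq> 0" using b vr_0[OF h_placesD(1)[OF V]] by auto
  have a0: "a \<noteq> 0" using a vr_0[OF h_placesD(1)[OF W]] by auto
  have "val V b < 0" "val W b \<ge> 0" using val_nonneg_iff[OF V b0] val_nonneg_iff[OF W b0] b by auto
  moreover have "val V a \<ge> 0" "val W a < 0" using val_nonneg_iff[OF V a0] val_nonneg_iff[OF W a0] a by auto
  ultimately show ?thesis using val_divide[OF V b0 a0] val_divide[OF W b0 a0] a0 b0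
    by (intro exI[of _ "b / a"]) auto
qed

lemma val_one_plus_pos:
  assumes V: "V \<in> h_places" and w: "w \<noteq> 0" "val V w > 0"
  shows "1 + w \<noteq> 0" "val V (1 + w) = 0"
  using val_add_dominated[OF V one_neq_zero, of "val V w" w] w val_1[OF V] val_ge_self[of V w] by auto

lemma val_one_plus_neg:
  assumes V: "V \<in> h_places" and w: "w \<noteq> 0" "val V w < 0"
  shows "1 + w \<noteq> 0" "val V (1 + w) = val V w"
proof -
  have "val_ge V 0 1" using val_1[OF V] by (simp add: val_ge_def)
  then have "w + 1 \<noteq> 0 \<and> val V (w + 1) = val V w" using val_add_dominated[OF V w(1), of 0 1] w by simp
  then show "1 + w \<noteq> 0" "val V (1 + w) = val V w" by (simp_all add: add.commute)
qed

lemma val_one_plus_power: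
  assumes V: "V \<in> h_places" and z: "z \<noteq> 0" "val V z \<noteq> 0" and N: "N > 0"
  shows "1 + z ^ N \<noteq> 0" "val V (1 + z ^ N) = min 0 (of_nat N * val V z)"
proof -
  have zN: "z ^ N \<noteq> 0" "val V (z ^ N) = of_nat N * val V z" using z val_power[OF V z(1)] by simp_all
  have "val V z < 0 \<or> val V z > 0" using z(2) by linarith
  then show "1 + z ^ N \<noteq> 0" "val V (1 + z ^ N) = min 0 (of_nat N * val V z)"
    using val_one_plus_neg[OF V zN(1)] val_one_plus_pos[OF V zN(1)] zN(2) N
    by (auto simp: mult_pos_neg zero_less_mult_iff)
qed

lemma separating_element_insert:
  assumes V0: "V0 \<in> h_places" and T: "finite T" "T \<subseteq> h_places" and Wn: "Wn \<in> h_places"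
    and z: "z \<noteq> 0" "val V0 z < 0" "\<forall>W\<in>T. val W z > 0"
    and y: "y \<noteq> 0" "val V0 y < 0" "val Wn y > 0"
  shows "\<exists>z'. z' \<noteq> 0 \<and> val V0 z' < 0 \<and> (\<forall>W\<in>insert Wn T. val W z' > 0)"
proof -
  obtain N where N: "N > 0" "\<forall>W\<in>T. - val W y < of_nat N * val W z"
    using exists_nat_mult_greater[OF T(1) z(3), of "\<lambda>W. - val W y"] by blast
  have vzN: "val V (z ^ N * y) = of_nat N * val V z + val V y" if "V \<in> h_places" for V
    using val_mult[OF that _ y(1)] val_power[OF that z(1)] z(1) by simp
  show ?thesis
  proof (cases "val Wn z < 0")
    case False
    have "val V0 (z ^ N * y) < 0"
      using vzN[OF V0] y(2) z(2) N(1) by (simp add: mult_pos_neg add_neg_neg)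
    moreover have "val Wn (z ^ N * y) > 0"
      using vzN[OF Wn] y(3) False by (simp add: add_nonneg_pos)
    moreover have "val W (z ^ N * y) > 0" if W: "W \<in> T" for W
      using vzN[of W] W T(2) bspec[OF N(2) W] by auto
    ultimately show ?thesis using z(1) y(1) by (intro exI[of _ "z ^ N * y"]) auto
  next
    case True
    text \<open>Dividing by \<open>1 + z\<^sup>N\<close> cancels the pole of \<open>z\<^sup>N\<close> at \<open>V0\<close> and \<open>Wn\<close>.\<close>
    define z' where "z' = z ^ N * y / (1 + z ^ N)"
    have vz': "z' \<noteq> 0 \<and> val V z' = max 0 (of_nat N * val V z) + val V y"
      if "V \<in> h_places" "val V z \<noteq> 0" for V
    proof -
      have "1 + z ^ N \<noteq> 0" "val V (1 + z ^ N) = min 0 (of_nat N * val V z)"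
        using val_one_plus_power[OF that(1) z(1) that(2) N(1)] by simp_all
      then show ?thesis
        using val_divide[OF that(1), of "z ^ N * y" "1 + z ^ N"] vzN[OF that(1)] z(1) y(1)
        by (simp add: z'_def)
    qed
    have "val V0 z' < 0" using vz'[OF V0] z(2) y(2) N(1) by (simp add: mult_pos_neg)
    moreover have "val Wn z' > 0" using vz'[OF Wn] True y(3) N(1) by (simp add: mult_pos_neg)
    moreover have "val W z' > 0" if W: "W \<in> T" for W
    proof -
      have "W \<in> h_places" "val W z > 0" using W T(2) z(3) by auto
      then show ?thesis using vz'[of W] bspec[OF N(2) W] by auto
    qed
    ultimately show ?thesis using vz'[OF V0] z(2) by (intro exI[of _ z']) auto
  qed
qed

lemma exists_separating_element:
  assumes V0: "V0 \<in> h_places" and T: "finite T" "T \<subseteq> h_places" "V0 \<notin> T"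
  shows "\<exists>z. z \<noteq> 0 \<and> val V0 z < 0 \<and> (\<forall>W\<in>T. val W z > 0)"
  using T
proof (induction T rule: finite_induct)
  case empty
  show ?case using val_inverse[OF V0 h_nonzero] val_h[OF V0] h_nonzero by (intro exI[of _ "inverse h"]) auto
next
  case (insert Wn T)
  then obtain z where "z \<noteq> 0" "val V0 z < 0" "\<forall>W\<in>T. val W z > 0" by auto
  moreover have "Wn \<in> h_places" "V0 \<noteq> Wn" using insert by auto
  then obtain y where "y \<noteq> 0" "val V0 y < 0" "val Wn y > 0"
    using exists_val_neg_pos[OF V0] by blast
  ultimately show ?case using separating_element_insert[OF V0 insert(1)] insert by auto
qed

lemma exists_approximate_idempotent:
  assumes V0: "V0 \<in> S" and S: "finite S" "S \<subseteq> h_places"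
  shows "\<exists>e. val_ge V0 R (e - 1) \<and> (\<forall>W\<in>S - {V0}. val_ge W R e)"
proof -
  have V0D: "V0 \<in> h_places" using V0 S by auto
  obtain z where z: "z \<noteq> 0" "val V0 z < 0" "\<forall>W\<in>S - {V0}. val W z > 0"
    using exists_separating_element[OF V0D, of "S - {V0}"] S by auto
  then have "\<forall>W\<in>S. \<bar>val W z\<bar> > 0" using V0 by force
  then obtain N where N: "N > 0" "\<forall>W\<in>S. R < of_nat N * \<bar>val W z\<bar>"
    using exists_nat_mult_greater[OF S(1), of "\<lambda>W. \<bar>val W z\<bar>" "\<lambda>_. R"] by blast
  have one_plus: "1 + z ^ N \<noteq> 0 \<and> val W (1 + z ^ N) = min 0 (of_nat N * val W z)"
    if "W \<in> S" "val W z \<noteq> 0" for W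
    using val_one_plus_power[OF _ z(1) that(2) N(1)] that(1) S(2) by auto
  define e where "e = z ^ N / (1 + z ^ N)"
  have "e - 1 = - inverse (1 + z ^ N)" using one_plus[OF V0] z(2) by (simp add: e_def field_simps)
  then have "val V0 (e - 1) = - of_nat N * val V0 z"
    using val_uminus[OF V0D] val_inverse[OF V0D] one_plus[OF V0] z(2) N(1) by (simp add: mult_pos_neg)
  moreover have "R < of_nat N * \<bar>val V0 z\<bar>" using N(2) V0 by blast
  ultimately have "val_ge V0 R (e - 1)" using z(2) by (simp add: val_ge_def)
  moreover have "val_ge W R e" if W: "W \<in> S - {V0}" for W
  proof -
    have "W \<in> h_places" "val W z > 0" using W S z(3) by auto
    then have "val W e = of_nat N * val W z"
      using one_plus[of W] W val_divide val_power z(1) N(1) by (simp add: e_def)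
    moreover have "R < of_nat N * \<bar>val W z\<bar>" using N(2) W by blast
    ultimately show ?thesis using \<open>val W z > 0\<close> by (simp add: val_ge_def)
  qed
  ultimately show ?thesis by blast
qed

lemma weak_approximation:
  assumes S: "finite S" "S \<subseteq> h_places"
  shows "\<exists>\<xi>. \<forall>V\<in>S. val_ge V (r V) (\<xi> - t V)"
proof -
  define R where "R = 1 + (\<Sum>V\<in>S. \<Sum>W\<in>S. \<bar>r V\<bar> + \<bar>val V (t W)\<bar>)"
  have Rb: "\<bar>r V\<bar> + \<bar>val V (t W)\<bar> \<le> R" if "V \<in> S" "W \<in> S" for V W
  proof -
    have "\<bar>r V\<bar> + \<bar>val V (t W)\<bar> \<le> (\<Sum>W\<in>S. \<bar>r V\<bar> + \<bar>val V (t W)\<bar>)"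
      by (rule member_le_sum) (use that S in auto)
    also have "\<dots> \<le> (\<Sum>V\<in>S. \<Sum>W\<in>S. \<bar>r V\<bar> + \<bar>val V (t W)\<bar>)"
      by (rule member_le_sum[where f = "\<lambda>V. \<Sum>W\<in>S. \<bar>r V\<bar> + \<bar>val V (t W)\<bar>"]) (use that S in \<open>auto intro: sum_nonneg\<close>)
    finally show ?thesis by (simp add: R_def)
  qed
  have "\<forall>W\<in>S. \<exists>e. val_ge W R (e - 1) \<and> (\<forall>V\<in>S-{W}. val_ge V R e)" using exists_approximate_idempotent S by blast
  then obtain e where e: "\<forall>W\<in>S. val_ge W R (e W - 1) \<and> (\<forall>V\<in>S-{W}. val_ge V R (e W))" by metis
  define \<xi> where "\<xi> = (\<Sum>W\<in>S. e W * t W)"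
  have "val_ge V (r V) (\<xi> - t V)" if V: "V \<in> S" for V
  proof -
    have VD: "V \<in> h_places" using V S by auto
    have trm: "val_ge V (r V) (g * t W)" if "W \<in> S" "val_ge V R g" for g W
    proof -
      have "val_ge V (R + val V (t W)) (g * t W)" using val_ge_mult[OF VD that(2) val_ge_self] .
      moreover have "r V \<le> R + val V (t W)" using Rb[OF V that(1)] by linarith
      ultimately show ?thesis using val_ge_mono by blast
    qed
    have "\<xi> - t V = (e V - 1) * t V + (\<Sum>W\<in>S-{V}. e W * t W)"
      unfolding \<xi>_def using sum.remove[OF S(1) V, of "\<lambda>W. e W * t W"] by (simp add: algebra_simps)
    moreover have "val_ge V (r V) ((e V - 1) * t V)" using trm[OF V] e V by blast
    moreover have "val_ge V (r V) (\<Sum>W\<in>S-{V}. e W * t W)"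
      using e V by (intro val_ge_sum[OF VD] trm) auto
    ultimately show ?thesis using val_ge_add[OF VD] by simp
  qed
  then show ?thesis by blast
qed

section \<open>Finiteness of the zeros and poles of \<open>f\<close>\<close>

text \<open>A zero denominator is harmless here, as \<open>a / 0 = 0\<close>.\<close>

definition F_of_f :: "'a set" where
  "F_of_f = {a / b | a b. a \<in> adjoin_ring F f \<and> b \<in> adjoin_ring F f}"

lemma subfield_F_of_f: "subfield F_of_f"
proof -
  note A = adjoin_ring_add[OF subfield_F] adjoin_ring_mult[OF subfield_F] adjoin_ring_uminus[OF subfield_F]
    adjoin_ring_const[OF subfield_F subfield_0[OF subfield_F]]
    adjoin_ring_const[OF subfield_F subfield_1[OF subfield_F]]
  have frac: "a / b \<in> F_of_f" if "a \<in> adjoin_ring F f" "b \<in> adjoin_ring F f" for a b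
    using that by (auto simp: F_of_f_def)
  have zero_one: "0 \<in> F_of_f" "1 \<in> F_of_f" using frac[of 0 1] frac[of 1 1] A by simp_all
  moreover have "x + y \<in> F_of_f \<and> x * y \<in> F_of_f" if xy: "x \<in> F_of_f" "y \<in> F_of_f" for x y
  proof -
    obtain a b where ab: "a \<in> adjoin_ring F f" "b \<in> adjoin_ring F f" "x = a / b"
      using xy(1) by (auto simp: F_of_f_def)
    obtain c d where cd: "c \<in> adjoin_ring F f" "d \<in> adjoin_ring F f" "y = c / d"
      using xy(2) by (auto simp: F_of_f_def)
    show ?thesis
    proof (cases "b = 0 \<or> d = 0")
      case True
      then show ?thesis using xy zero_one ab(3) cd(3) by auto
    next
      case False
      then have "x + y = (a * d + c * b) / (b * d)" "x * y = (a * c) / (b * d)"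
        using ab(3) cd(3) by (simp_all add: field_simps)
      moreover have "a * d + c * b \<in> adjoin_ring F f" "a * c \<in> adjoin_ring F f" "b * d \<in> adjoin_ring F f"
        using ab cd A by blast+
      ultimately show ?thesis using frac by simp
    qed
  qed
  moreover have "- x \<in> F_of_f \<and> inverse x \<in> F_of_f" if x: "x \<in> F_of_f" for x
  proof -
    obtain a b where ab: "a \<in> adjoin_ring F f" "b \<in> adjoin_ring F f" "x = a / b"
      using x by (auto simp: F_of_f_def)
    have "- x = (- a) / b" "inverse x = b / a" using ab(3) by (simp_all only: minus_divide_left inverse_divide)
    then show ?thesis using frac[OF A(3)[OF ab(1)] ab(2)] frac[OF ab(2) ab(1)] by simp
  qed
  ultimately show ?thesis using zero_one unfolding subfield_def by blast
qed

lemma algebraic_over_F_of_f: "algebraic_over F_of_f y"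
proof (rule algebraic_over_mono[OF _ algebraic])
  have "x / 1 \<in> F_of_f" if "x \<in> adjoin_ring F f" for x
    using that adjoin_ring_const[OF subfield_F subfield_1[OF subfield_F]] unfolding F_of_f_def by blast
  then show "adjoin_ring F f \<subseteq> F_of_f" by auto
qed

lemma F_of_f_val_constant:
  assumes c: "c \<in> F_of_f" "c \<noteq> 0" and P: "P = (\<lambda>V. f \<in> V) \<or> P = (\<lambda>V. f \<notin> V)"
  shows "\<exists>k. \<forall>V\<in>h_places. P V \<longrightarrow> val V c = k"
proof -
  obtain a b where ab: "a \<in> adjoin_ring F f" "b \<in> adjoin_ring F f" "c = a / b"
    using c(1) by (auto simp: F_of_f_def)
  have nz: "a \<noteq> 0" "b \<noteq> 0" using ab(3) c(2) by auto
  have int_val: "\<exists>k. \<forall>V\<in>h_places. P V \<longrightarrow> val V x = of_int k"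
    if x: "x \<in> adjoin_ring F f" "x \<noteq> 0" for x
  proof -
    obtain k where "\<forall>V\<in>h_places. P V \<longrightarrow> x * h powi (- k) \<in> vr_units V"
      using P adjoin_ring_val_at_zeros[OF x] adjoin_ring_val_at_poles[OF x] by blast
    then show ?thesis using val_eq[of _ 1 x k] by auto
  qed
  obtain ka kb where "\<forall>V\<in>h_places. P V \<longrightarrow> val V a = of_int ka" "\<forall>V\<in>h_places. P V \<longrightarrow> val V b = of_int kb"
    using int_val ab(1,2) nz by metis
  then show ?thesis using val_divide nz ab(3) by (intro exI[of _ "of_int ka - of_int kb"]) auto
qed

text \<open>In a relation, the term whose coefficient has least value dominates at its own place.\<close>

lemma idempotents_independent:
  assumes S: "finite S" "S \<subseteq> h_places"
    and e: "\<forall>V\<in>S. val_ge V 1 (e V - 1) \<and> (\<forall>W\<in>S - {V}. val_ge W 1 (e V))"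
    and c: "\<forall>V\<in>S. c V \<noteq> 0 \<longrightarrow> (\<forall>W\<in>S. val W (c V) = val V (c V))"
    and rel: "(\<Sum>V\<in>S. c V * e V) = 0"
  shows "\<forall>V\<in>S. c V = 0"
proof (rule ccontr)
  define J where "J = {V\<in>S. c V \<noteq> 0}"
  assume "\<not> (\<forall>V\<in>S. c V = 0)"
  then have J: "finite J" "J \<noteq> {}" using S(1) by (auto simp: J_def)
  have "Min ((\<lambda>V. val V (c V)) ` J) \<in> (\<lambda>V. val V (c V)) ` J" using J by (intro Min_in) auto
  then obtain V1 where V1: "V1 \<in> J" "Min ((\<lambda>V. val V (c V)) ` J) = val V1 (c V1)" by blast
  then have V1_min: "\<forall>V\<in>J. val V1 (c V1) \<le> val V (c V)" using J(1) by (metis Min_le finite_imageI imageI)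
  have V1S: "V1 \<in> S" and V1D: "V1 \<in> h_places" and cV1: "c V1 \<noteq> 0" using V1(1) S(2) by (auto simp: J_def)
  have "val_ge V1 1 (e V1 - 1)" using e V1S by blast
  moreover have "1 > val V1 1" using val_1[OF V1D] by simp
  ultimately have "1 + (e V1 - 1) \<noteq> 0" "val V1 (1 + (e V1 - 1)) = val V1 1"
    by (rule val_add_dominated[OF V1D one_neq_zero])+
  then have e1: "e V1 \<noteq> 0" "val V1 (e V1) = 0" using val_1[OF V1D] by simp_all
  have t: "c V1 * e V1 \<noteq> 0" "val V1 (c V1 * e V1) = val V1 (c V1)"
    using val_mult[OF V1D cV1 e1(1)] cV1 e1 by simp_all
  have rest: "val_ge V1 (val V1 (c V1 * e V1) + 1) (\<Sum>V\<in>S - {V1}. c V * e V)"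
  proof (rule val_ge_sum[OF V1D])
    fix V assume V: "V \<in> S - {V1}"
    show "val_ge V1 (val V1 (c V1 * e V1) + 1) (c V * e V)"
    proof (cases "c V = 0")
      case False
      then have "V \<in> J" using V by (simp add: J_def)
      then have "val V1 (c V1) \<le> val V (c V)" using V1_min by blast
      moreover have "val V1 (c V) = val V (c V)" using c V V1S False by blast
      moreover have "val_ge V1 1 (e V)" using e V V1S by blast
      then have "val_ge V1 (val V1 (c V) + 1) (c V * e V)" by (rule val_ge_mult[OF V1D val_ge_self])
      ultimately show ?thesis using t(2) val_ge_mono[of "val V1 (c V1) + 1" "val V (c V) + 1"] by simp
    qed (simp add: val_ge_0)
  qed
  have "(\<Sum>V\<in>S. c V * e V) = c V1 * e V1 + (\<Sum>V\<in>S - {V1}. c V * e V)"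
    using sum.remove[OF S(1) V1S] .
  moreover have "c V1 * e V1 + (\<Sum>V\<in>S - {V1}. c V * e V) \<noteq> 0"
    using val_add_dominated(1)[OF V1D t(1) rest] by simp
  ultimately show False using rel by simp
qed

lemma finite_if_val_constant:
  assumes C: "C \<subseteq> h_places"
    and const: "\<forall>c\<in>F_of_f. c \<noteq> 0 \<longrightarrow> (\<forall>V\<in>C. \<forall>W\<in>C. val V c = val W c)"
  shows "finite C"
proof (rule ccontr)
  assume "infinite C"
  obtain B where B: "finite B" "span_over F_of_f B = UNIV"
    using finite_span_if_algebraic[OF subfield_F_of_f finitely_generated algebraic_over_F_of_f] by blast
  obtain S where S: "finite S" "card S = Suc (card B)" "S \<subseteq> C"
    using infinite_arbitrarily_large[OF \<open>infinite C\<close>] by blast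
  have SD: "S \<subseteq> h_places" using S C by blast
  have "\<forall>V\<in>S. \<exists>e. val_ge V 1 (e - 1) \<and> (\<forall>W\<in>S - {V}. val_ge W 1 e)"
    using exists_approximate_idempotent[OF _ S(1) SD] by blast
  then obtain e where e: "\<forall>V\<in>S. val_ge V 1 (e V - 1) \<and> (\<forall>W\<in>S - {V}. val_ge W 1 (e V))"
    by metis
  have "e V \<in> span_over F_of_f B" for V using B(2) by simp
  then have "\<forall>V\<in>S. \<exists>a. (\<forall>b\<in>B. a b \<in> F_of_f) \<and> e V = (\<Sum>b\<in>B. a b * b)"
    unfolding span_over_def by blast
  then obtain a where a: "\<forall>V\<in>S. (\<forall>b\<in>B. a V b \<in> F_of_f) \<and> e V = (\<Sum>b\<in>B. a V b * b)" by metis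
  obtain c where c: "\<forall>V\<in>S. c V \<in> F_of_f" "\<exists>V\<in>S. c V \<noteq> 0" "\<forall>b\<in>B. (\<Sum>V\<in>S. c V * a V b) = 0"
    using homogeneous_system_nontrivial_solution[OF subfield_F_of_f B(1) S(1), of a] S(2) a by auto
  have "(\<Sum>V\<in>S. c V * e V) = (\<Sum>V\<in>S. \<Sum>b\<in>B. c V * a V b * b)"
    using a by (intro sum.cong) (simp_all add: sum_distrib_left mult.assoc)
  also have "\<dots> = (\<Sum>b\<in>B. (\<Sum>V\<in>S. c V * a V b) * b)"
    by (subst sum.swap) (simp add: sum_distrib_right)
  also have "\<dots> = 0" using c(3) by simp
  finally have "\<forall>V\<in>S. c V = 0"
  proof (rule idempotents_independent[OF S(1) SD e, rotated])
    show "\<forall>V\<in>S. c V \<noteq> 0 \<longrightarrow> (\<forall>W\<in>S. val W (c V) = val V (c V))"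
      using const c(1) S(3) by blast
  qed
  then show False using c(2) by blast
qed

lemma finite_h_places: "finite h_places"
proof -
  have "finite {V\<in>h_places. P V}" if P: "P = (\<lambda>V. f \<in> V) \<or> P = (\<lambda>V. f \<notin> V)" for P
  proof (rule finite_if_val_constant)
    show "\<forall>c\<in>F_of_f. c \<noteq> 0 \<longrightarrow> (\<forall>V\<in>{V\<in>h_places. P V}. \<forall>W\<in>{V\<in>h_places. P V}. val V c = val W c)"
    proof (intro ballI impI)
      fix c V W assume c: "c \<in> F_of_f" "c \<noteq> 0" and VW: "V \<in> {V\<in>h_places. P V}" "W \<in> {V\<in>h_places. P V}"
      obtain k where "\<forall>V\<in>h_places. P V \<longrightarrow> val V c = k" using F_of_f_val_constant[OF c P] by blast
      then show "val V c = val W c" using VW by simp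
    qed
  qed auto
  then have "finite ({V\<in>h_places. f \<in> V} \<union> {V\<in>h_places. f \<notin> V})" by blast
  moreover have "h_places = {V\<in>h_places. f \<in> V} \<union> {V\<in>h_places. f \<notin> V}" by blast
  ultimately show ?thesis by simp
qed

section \<open>Elements of odd value and the identity\<close>

lemma Dset_subset_h_places: "Dset F f \<subseteq> h_places"
proof
  fix V assume V: "V \<in> Dset F f"
  note vr = Dset_valuation_ring[OF V]
  have "f \<notin> vr_units V"
    using V val_evenI[of 1 f V] by (auto simp: Dset_def)
  then have "f \<in> max_ideal V \<or> inverse f \<in> max_ideal V"
    using vr_mem_cases[OF vr] vr_total[OF vr f_nonzero] by (auto simp: max_ideal_iff[OF vr])
  moreover have "h = inverse ((1 + f) ^ 2) * f" "h = inverse ((1 + inverse f) ^ 2) * inverse f"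
    using f_nonzero one_plus_f_nonzero by (simp_all add: h_def field_simps power2_eq_square)
  moreover have "inverse ((1 + y) ^ 2) \<in> V" if "y \<in> max_ideal V" for y
    using vr_units_mem[OF vr] vr_units_inverse[OF vr] vr_units_power[OF vr]
      vr_units_add_max_ideal[OF vr vr_units_1[OF vr] that] by blast
  ultimately have "h \<in> max_ideal V" using max_ideal_mult[OF vr] by metis
  then show "V \<in> h_places" using V by (auto simp: h_places_def Dset_def curve_points_def)
qed

lemma finite_Dset: "finite (Dset F f)"
  using finite_subset[OF Dset_subset_h_places finite_h_places] .

lemma val_even_iff:
  assumes V: "V \<in> h_places" and y: "y \<noteq> 0"
  shows "val_even V y \<longleftrightarrow> (\<exists>g. g \<noteq> 0 \<and> val V y = 2 * val V g)"
proof -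
  have "val V (y * inverse (g ^ 2)) = val V y - 2 * val V g" if "g \<noteq> 0" for g
    using val_mult[OF V y, of "inverse (g ^ 2)"] val_inverse[OF V, of "g ^ 2"] val_power[OF V that, of 2] that
    by simp
  then show ?thesis
    using val_unit[OF V] val_zero_iff[OF V] y unfolding val_even_def
    by (metis eq_iff_diff_eq_0 inverse_nonzero_iff_nonzero mult_eq_0_iff power_not_zero)
qed

lemma val_even_cong:
  assumes "V \<in> h_places" "y \<noteq> 0" "z \<noteq> 0" "val V y = val V z"
  shows "val_even V y \<longleftrightarrow> val_even V z"
  using assms by (simp add: val_even_iff)

text \<open>At a place of \<open>Dset F f\<close>, \<open>v(f) = \<plusminus>1\<close> while \<open>f\<close> is not even.\<close>

lemma val_ne_half:
  assumes V: "V \<in> Dset F f" and g: "g \<noteq> 0"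
  shows "2 * val V g \<noteq> 1"
proof
  assume g1: "2 * val V g = 1"
  have VD: "V \<in> h_places" using V Dset_subset_h_places by blast
  have "val V f = 1 \<or> val V f = - 1"
  proof (cases "f \<in> V")
    case True
    then show ?thesis
      using val_unit[OF VD zero_of_f(2)[OF VD True]] val_divide[OF VD f_nonzero h_nonzero] val_h[OF VD] by simp
  next
    case False
    then show ?thesis
      using val_unit[OF VD pole_of_f(2)[OF VD False]] val_mult[OF VD f_nonzero h_nonzero] val_h[OF VD] by simp
  qed
  then have "val V f = 2 * val V g \<or> val V f = 2 * val V (inverse g)"
    using g1 val_inverse[OF VD g] by auto
  then have "val_even V f" using val_even_iff[OF VD f_nonzero] g by (metis inverse_nonzero_iff_nonzero)
  then show False using V by (simp add: Dset_def)
qed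

lemma h_in_Theta_bar: "h \<in> Theta_bar F f"
proof (rule Theta_barI[OF h_nonzero], intro ballI conjI)
  fix V assume V: "V \<in> Dset F f"
  then have VD: "V \<in> h_places" using Dset_subset_h_places by blast
  show "h \<in> max_ideal V" using h_placesD(3)[OF VD] .
  show "\<not> val_even V h"
    using val_even_iff[OF VD h_nonzero] val_ne_half[OF V] val_h[OF VD] by auto
qed

lemma exists_val_unit_fraction:
  assumes V: "V \<in> h_places" and y: "y \<noteq> 0" and pq: "quotient_of (val V y) = (p, q)"
  shows "\<exists>z. z \<noteq> 0 \<and> val V z = 1 / of_int q"
proof -
  have q0: "q > 0" and vy: "val V y = of_int p / of_int q" and "coprime q p"
    using quotient_of_denom_pos[OF pq] quotient_of_div[OF pq] quotient_of_coprime[OF pq]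
    by (simp_all add: coprime_commute)
  then obtain u v where uv: "u * q + v * p = 1" using bezout_int[of q p] by (auto simp: coprime_iff_gcd_eq_1)
  define z where "z = h powi u * y powi v"
  have "val V z = of_int u + of_int v * val V y"
    using val_mult[OF V, of "h powi u" "y powi v"] val_powi[OF V h_nonzero, of u] val_powi[OF V y, of v]
      val_h[OF V] h_nonzero y by (simp add: z_def power_int_not_zero)
  also have "\<dots> = (of_int u * of_int q + of_int v * of_int p) / of_int q"
    using q0 vy by (simp add: field_simps)
  also have "\<dots> = 1 / of_int q" using uv by (metis of_int_1 of_int_add of_int_mult)
  finally show ?thesis using h_nonzero y by (intro exI[of _ z]) (simp add: z_def power_int_not_zero)
qed

lemma exists_odd_above:
  assumes V: "V \<in> Dset F f" and x: "x \<noteq> 0" "val V x > 0" "\<not> val_even V x"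
  shows "\<exists>z. z \<noteq> 0 \<and> val V z > val V x \<and> \<not> val_even V z"
proof -
  have VD: "V \<in> h_places" using V Dset_subset_h_places by blast
  define z where "z = h * x ^ 2"
  have z0: "z \<noteq> 0" using h_nonzero x by (simp add: z_def)
  have vz: "val V z = 1 + 2 * val V x"
    using val_mult[OF VD h_nonzero, of "x ^ 2"] val_h[OF VD] val_power[OF VD x(1), of 2] x(1)
    by (simp add: z_def)
  have "val V z \<noteq> 2 * val V g" if "g \<noteq> 0" for g
    using val_ne_half[OF V, of "g / x"] val_divide[OF VD that x(1)] vz that x(1) by simp
  then show ?thesis using z0 vz x(2) val_even_iff[OF VD z0] by (intro exI[of _ z]) auto
qed

text \<open>If \<open>v(x) = p/q\<close> is even, an element of value \<open>1/q\<close> is odd, as \<open>1\<close> is not twice a value; hence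
  \<open>p \<noteq> 1\<close> and that element lies below \<open>x\<close>.\<close>

lemma exists_odd_below:
  assumes V: "V \<in> Dset F f" and x: "x \<noteq> 0" "val V x > 0" "val_even V x"
  shows "\<exists>z. z \<noteq> 0 \<and> val V z > 0 \<and> val V z < val V x \<and> \<not> val_even V z"
proof -
  have VD: "V \<in> h_places" using V Dset_subset_h_places by blast
  obtain g0 where g0: "g0 \<noteq> 0" "val V x = 2 * val V g0" using x(3) val_even_iff[OF VD x(1)] by auto
  obtain p q where pq: "quotient_of (val V x) = (p, q)" by (cases "quotient_of (val V x)")
  have q0: "q > 0" and vx: "val V x = of_int p / of_int q"
    using quotient_of_denom_pos[OF pq] quotient_of_div[OF pq] by simp_all
  obtain z where z: "z \<noteq> 0" "val V z = 1 / of_int q"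
    using exists_val_unit_fraction[OF VD x(1) pq] by blast
  have odd: "val V z \<noteq> 2 * val V g" if "g \<noteq> 0" for g
    using val_ne_half[OF V, of "g powi q"] val_powi[OF VD that, of q] z(2) that q0
    by (auto simp: field_simps power_int_not_zero)
  then have "p \<noteq> 1" using odd[OF g0(1)] z(2) vx g0(2) by auto
  then have "val V z < val V x" using x(2) vx q0 z(2) by (simp add: zero_less_divide_iff divide_strict_right_mono)
  then show ?thesis using z q0 odd val_even_iff[OF VD z(1)] by (intro exI[of _ z]) auto
qed

lemma exists_odd_with_odd_difference:
  assumes V: "V \<in> Dset F f" and x: "x \<noteq> 0" "x \<in> max_ideal V"
  shows "\<exists>z. z \<noteq> 0 \<and> z - x \<noteq> 0 \<and> val V z > 0 \<and> val V (z - x) > 0 \<and>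
     \<not> val_even V z \<and> \<not> val_even V (z - x)"
proof -
  have VD: "V \<in> h_places" using V Dset_subset_h_places by blast
  have vx: "val V x > 0" using val_pos_iff[OF VD x(1)] x(2) by simp
  have mx: "- x \<noteq> 0" "val V (- x) = val V x" using x(1) val_uminus[OF VD] by auto
  show ?thesis
  proof (cases "val_even V x")
    case False
    then obtain z where z: "z \<noteq> 0" "val V z > val V x" "\<not> val_even V z"
      using exists_odd_above[OF V x(1) vx] by blast
    have "- x + z \<noteq> 0" "val V (- x + z) = val V (- x)"
      using val_add_dominated[OF VD mx(1) val_ge_self[of V z]] z(2) mx(2) by simp_all
    then have zx: "z - x \<noteq> 0" "val V (z - x) = val V x" using mx(2) by (simp_all add: add.commute)
    then have "\<not> val_even V (z - x)" using val_even_cong[OF VD zx(1) x(1)] False by simp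
    then show ?thesis using z vx zx by (intro exI[of _ z]) simp
  next
    case True
    then obtain z where z: "z \<noteq> 0" "val V z > 0" "val V z < val V x" "\<not> val_even V z"
      using exists_odd_below[OF V x(1) vx] by blast
    have "z + - x \<noteq> 0" "val V (z + - x) = val V z"
      using val_add_dominated[OF VD z(1) val_ge_self[of V "- x"]] z(3) mx(2) by simp_all
    then have zx: "z - x \<noteq> 0" "val V (z - x) = val V z" by simp_all
    then have "\<not> val_even V (z - x)" using val_even_cong[OF VD zx(1) z(1)] z(4) by simp
    then show ?thesis using z zx by (intro exI[of _ z]) simp
  qed
qed

lemma exists_with_prescribed_vals:
  assumes S: "finite S" "S \<subseteq> h_places" and t: "\<forall>V\<in>S. t V \<noteq> 0 \<and> t V - x \<noteq> 0"
  shows "\<exists>\<xi>. \<forall>V\<in>S. \<xi> \<noteq> 0 \<and> val V \<xi> = val V (t V) \<and> \<xi> - x \<noteq> 0 \<and> val V (\<xi> - x) = val V (t V - x)"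
proof -
  obtain \<xi> where \<xi>: "\<forall>V\<in>S. val_ge V (max (val V (t V)) (val V (t V - x)) + 1) (\<xi> - t V)"
    using weak_approximation[OF S, of "\<lambda>V. max (val V (t V)) (val V (t V - x)) + 1" t] by blast
  have "\<xi> \<noteq> 0 \<and> val V \<xi> = val V (t V) \<and> \<xi> - x \<noteq> 0 \<and> val V (\<xi> - x) = val V (t V - x)" if V: "V \<in> S" for V
  proof -
    have VD: "V \<in> h_places" using V S by blast
    have ge: "val_ge V (max (val V (t V)) (val V (t V - x)) + 1) (\<xi> - t V)" using \<xi> V by blast
    have t0: "t V \<noteq> 0" "t V - x \<noteq> 0" using t V by auto
    have "t V + (\<xi> - t V) \<noteq> 0" "val V (t V + (\<xi> - t V)) = val V (t V)"
      by (rule val_add_dominated[OF VD t0(1) ge]; simp)+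
    moreover have "(t V - x) + (\<xi> - t V) \<noteq> 0" "val V ((t V - x) + (\<xi> - t V)) = val V (t V - x)"
      by (rule val_add_dominated[OF VD t0(2) ge]; simp)+
    ultimately show ?thesis by simp
  qed
  then show ?thesis by blast
qed

lemma diff_of_nonzero: "\<exists>a b. a \<noteq> 0 \<and> b \<noteq> 0 \<and> (x :: 'a) = a - b"
proof (cases "x + f = 0")
  case True
  then have "x = 1 - (1 + f)" by (simp add: algebra_simps eq_neg_iff_add_eq_0)
  then show ?thesis using one_plus_f_nonzero by (intro exI[of _ 1] exI[of _ "1 + f"]) simp
next
  case False
  then show ?thesis using f_nonzero by (intro exI[of _ "x + f"] exI[of _ f]) simp
qed

lemma odd_positive_in_Theta_bar:
  assumes y: "y \<noteq> 0" and odd: "\<forall>V\<in>Dset F f. val V y > 0 \<and> \<not> val_even V y"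
  shows "y \<in> Theta_bar F f"
proof (rule Theta_barI[OF y], intro ballI conjI)
  fix V assume "V \<in> Dset F f"
  then show "y \<in> max_ideal V" "\<not> val_even V y"
    using odd val_pos_iff[OF _ y] Dset_subset_h_places by auto
qed

lemma nonzero_ideal_a_in_set_diff:
  assumes x: "x \<in> ideal_a F f" "x \<noteq> 0" and D: "Dset F f \<noteq> {}"
  shows "x \<in> set_diff (Theta_bar F f) (Theta_bar F f)"
proof -
  have "\<forall>V\<in>Dset F f. \<exists>z. z \<noteq> 0 \<and> z - x \<noteq> 0 \<and> val V z > 0 \<and>
      val V (z - x) > 0 \<and> \<not> val_even V z \<and> \<not> val_even V (z - x)"
    using exists_odd_with_odd_difference x by (simp add: ideal_a_def)
  then obtain z where z: "\<forall>V\<in>Dset F f. z V \<noteq> 0 \<and> z V - x \<noteq> 0 \<and> val V (z V) > 0 \<and>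
      val V (z V - x) > 0 \<and> \<not> val_even V (z V) \<and> \<not> val_even V (z V - x)"
    by metis
  then obtain \<xi> where \<xi>: "\<forall>V\<in>Dset F f. \<xi> \<noteq> 0 \<and> val V \<xi> = val V (z V) \<and> \<xi> - x \<noteq> 0 \<and>
      val V (\<xi> - x) = val V (z V - x)"
    using exists_with_prescribed_vals[OF finite_Dset Dset_subset_h_places] by blast
  have nonzero: "\<xi> \<noteq> 0" "\<xi> - x \<noteq> 0" using \<xi> D by auto
  have "val V \<xi> > 0 \<and> \<not> val_even V \<xi> \<and> val V (\<xi> - x) > 0 \<and> \<not> val_even V (\<xi> - x)"
    if V: "V \<in> Dset F f" for V
  proof -
    have VD: "V \<in> h_places" using V Dset_subset_h_places by blast
    show ?thesis
      using z \<xi> V val_even_cong[OF VD nonzero(1), of "z V"] val_even_cong[OF VD nonzero(2), of "z V - x"]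
      by auto
  qed
  then have "\<xi> \<in> Theta_bar F f" "\<xi> - x \<in> Theta_bar F f"
    using nonzero by (auto intro!: odd_positive_in_Theta_bar)
  moreover have "x = \<xi> - (\<xi> - x)" by simp
  ultimately show ?thesis unfolding set_diff_def by blast
qed

lemma ideal_a_subset_set_diff: "ideal_a F f \<subseteq> set_diff (Theta_bar F f) (Theta_bar F f)"
proof
  fix x assume x: "x \<in> ideal_a F f"
  consider "x = 0" | "Dset F f = {}" | "x \<noteq> 0" "Dset F f \<noteq> {}" by blast
  then show "x \<in> set_diff (Theta_bar F f) (Theta_bar F f)"
  proof cases
    case 1
    then show ?thesis using h_in_Theta_bar by (auto simp: set_diff_def)
  next
    case 2
    then show ?thesis using diff_of_nonzero[of x] by (auto simp: set_diff_def Theta_bar_if_Dset_empty)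
  next
    case 3
    then show ?thesis using nonzero_ideal_a_in_set_diff[OF x] by blast
  qed
qed

lemma multipliers_subset_ring_R:
  assumes r: "\<forall>x\<in>ideal_a F f. r * x \<in> ideal_a F f"
  shows "r \<in> ring_R F f"
proof -
  have "r \<in> V0" if V0: "V0 \<in> Dset F f" for V0
  proof (rule ccontr)
    assume "r \<notin> V0"
    have V0D: "V0 \<in> h_places" using V0 Dset_subset_h_places by blast
    have r0: "r \<noteq> 0" using \<open>r \<notin> V0\<close> vr_0[OF h_placesD(1)[OF V0D]] by auto
    have "val V0 r < 0" using val_nonneg_iff[OF V0D r0] \<open>r \<notin> V0\<close> by simp
    define t where "t V = (if V = V0 then inverse r else h)" for V
    have t: "t V \<noteq> 0 \<and> val V (t V) > 0" if "V \<in> Dset F f" for V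
      using that val_h val_inverse[OF V0D r0] \<open>val V0 r < 0\<close> Dset_subset_h_places r0 h_nonzero
      by (auto simp: t_def)
    then obtain \<xi> where \<xi>: "\<forall>V\<in>Dset F f. \<xi> \<noteq> 0 \<and> val V \<xi> = val V (t V)"
      using exists_with_prescribed_vals[OF finite_Dset Dset_subset_h_places, of t 0] by auto
    have "\<xi> \<in> max_ideal V" if V: "V \<in> Dset F f" for V
      using val_pos_iff[of V \<xi>] Dset_subset_h_places t[OF V] \<xi> V by auto
    then have "\<xi> \<in> ideal_a F f" by (simp add: ideal_a_def)
    then have "r * \<xi> \<in> max_ideal V0" using r V0 by (auto simp: ideal_a_def)
    moreover have "r * \<xi> \<noteq> 0" "val V0 (r * \<xi>) = 0"
      using val_mult[OF V0D r0] \<xi> V0 val_inverse[OF V0D r0] r0 by (simp_all add: t_def)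
    ultimately show False using val_pos_iff[OF V0D] by simp
  qed
  then show ?thesis by (simp add: ring_R_def)
qed

theorem ideal_a_eq_set_diff: "ideal_a F f = set_diff (Theta_bar F f) (Theta_bar F f)"
  using ideal_a_subset_set_diff set_diff_Theta_bar_subset by blast

theorem ring_R_eq_multipliers: "ring_R F f = {r. \<forall>x\<in>ideal_a F f. r * x \<in> ideal_a F f}"
  using multipliers_of_ideal_a multipliers_subset_ring_R by blast

end

theorem lemma4p6:
  fixes k0 :: "'a::field set" and f :: 'a and ts :: "'a list" and d e :: nat
  assumes "fg_field (UNIV :: 'a set)"
    and "CHAR('a) \<noteq> 2"
    and "kdim (UNIV :: 'a set) d" and "d > 2"
    and "global_subfield k0" and "rel_alg_closed k0"
    and "trdeg_in k0 (UNIV :: 'a set) (e + 1)" and "e > 0"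
    and "length ts = e" and "alg_indep k0 (f # ts)"
    and "\<forall>t\<in>set ts. \<exists>s. t = s ^ 2"
  shows "ideal_a (gen_subfield (k0 \<union> set ts)) f
           = set_diff (Theta_bar (gen_subfield (k0 \<union> set ts)) f)
                      (Theta_bar (gen_subfield (k0 \<union> set ts)) f)
       \<and> ring_R (gen_subfield (k0 \<union> set ts)) f
           = {r. \<forall>x\<in>ideal_a (gen_subfield (k0 \<union> set ts)) f.
                   r * x \<in> ideal_a (gen_subfield (k0 \<union> set ts)) f}"
proof -
  let ?F = "gen_subfield (k0 \<union> set ts)"
  have k0: "subfield k0" using assms(5) by (simp add: global_subfield_def fg_field_def)
  have F: "subfield ?F" "k0 \<subseteq> ?F" "set ts \<subseteq> ?F"
    using subfield_gen_subfield gen_subfield_superset[of "k0 \<union> set ts"] by auto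
  have "\<not> alg_indep k0 ((f # ts) @ [y])" for y
    using assms(7,9) by (auto simp: trdeg_in_def)
  then have "algebraic_over (adjoin_ring ?F f) y" for y
    using algebraic_over_adjoin_if_dependent[OF F(1) k0 F(2,3) assms(10)] by blast
  then interpret algebraic_function_field ?F f
    using F(1) alg_indep_Cons_nonzero[OF k0 assms(10)] assms(1) by unfold_locales auto
  show ?thesis using ideal_a_eq_set_diff ring_R_eq_multipliers by simp
qed

end
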